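(* Let $f\in L_{2\pi}$ be a complex-valued function with Fourier coefficients $\hat f(n)$, $n\in\mathbb{Z}$, and let $\{\psi_n\}$ be a decreasing sequence tending to zero such that $\psi_n\sim\psi_{2n}$, i.e. there exist positive constants $C_1,C_2$ with $C_1\psi_n\le\psi_{2n}\le C_2\psi_n$ for all $n$. Suppose that both $\{\hat f(n)\}_{n=0}^{+\infty}\in MVBVS$ and $\{\hat f(-n)\}_{n=0}^{+\infty}\in MVBVS$. Then $$\|f-S_n(f)\|_L=O(\psi_n)\quad (n\to\infty)$$ if and only if $$E_n(f)_L=O(\psi_n)\quad (n\to\infty)\qquad\text{and}\qquad \hat f(n)\log|n|=O(\psi_{|n|})\quad(|n|\to\infty).$$
   Context: $L_{2\pi}$ is the space of complex-valued integrable functions of period $2\pi$ with norm $\|f\|_L=\int_{-\pi}^{\pi}|f(x)|\,dx$. The Fourier coefficients of $f$ are $\hat f(k)=\frac1{2\pi}\int_{-\pi}^{\pi}f(x)e^{-ikx}\,dx$, $k\in\mathbb{Z}$, and the partial sums are $S_n(f,x)=\sum_{k=-n}^{n}\hat f(k)e^{ikx}$. $[x]$ denotes the integer part of $x$. The best $L^1$ approximation by trigonometric polynomials of degree $n$ is $$E_n(f)_L=\inf_{c_k\in\mathbb{C}}\Big\|f-\sum_{k=-n}^{n}c_ke^{ikx}\Big\|_L.$$ For $\theta\in[0,\pi/2)$ let $K(\theta)=\{z\in\mathbb{C}:|\arg z|\le\theta\}$ (with $0\in K(\theta)$). A complex sequence $\mathbf{c}=\{c_n\}_{n=0}^\infty$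 belongs to $MVBVS$ (mean value bounded variation sequences) if there is some $\theta_1\in[0,\pi/2)$ with $c_n\in K(\theta_1)$ for all $n\ge 0$, and there are a number $\lambda\ge2$ and a positive constant $C(\mathbf{c})$ depending only on the sequence such that $$\sum_{k=m}^{2m}|c_{k+1}-c_k|\le \frac{C(\mathbf{c})}{m}\sum_{k=[\lambda^{-1}m]}^{[\lambda m]}|c_k|\qquad\text{for all } m=1,2,\dots.$$ *)

theory Defs
  imports "HOL-Analysis.Analysis" "HOL-Library.Landau_Symbols"
begin

text \<open>
  Integrals are Lebesgue integrals with respect to the completed measure, so functions are only
  required to be Lebesgue (not Borel) measurable. Elements of \<open>L_2pi\<close> are functions rather than
  equivalence classes.
\<close>

definition L_2pi :: "(real \<Rightarrow> complex) set" where
  "L_2pi = {f. set_integrable lebesgue {-pi..pi} f \<and> (\<forall>x. f (x + 2 * pi) = f x)}"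

definition L_norm :: "(real \<Rightarrow> complex) \<Rightarrow> real" where
  "L_norm f = (LINT x:{-pi..pi}|lebesgue. cmod (f x))"

definition fourier_coeff :: "(real \<Rightarrow> complex) \<Rightarrow> int \<Rightarrow> complex" where
  "fourier_coeff f k =
     1 / (2 * of_real pi) * (LINT x:{-pi..pi}|lebesgue. f x * exp (- (\<i> * of_int k * of_real x)))"

definition trig_poly :: "nat \<Rightarrow> (int \<Rightarrow> complex) \<Rightarrow> real \<Rightarrow> complex" where
  "trig_poly n c x = (\<Sum>k\<in>{- int n..int n}. c k * exp (\<i> * of_int k * of_real x))"

definition fourier_partial_sum :: "nat \<Rightarrow> (real \<Rightarrow> complex) \<Rightarrow> real \<Rightarrow> complex" where
  "fourier_partial_sum n f = trig_poly n (fourier_coeff f)"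

definition best_approx :: "nat \<Rightarrow> (real \<Rightarrow> complex) \<Rightarrow> real" where
  "best_approx n f = (INF c. L_norm (\<lambda>x. f x - trig_poly n c x))"

definition sector :: "real \<Rightarrow> complex set" where
  "sector \<theta> = {z. z = 0 \<or> \<bar>Arg z\<bar> \<le> \<theta>}"

definition MVBVS :: "(nat \<Rightarrow> complex) set" where
  "MVBVS = {c.
     (\<exists>\<theta>. 0 \<le> \<theta> \<and> \<theta> < pi / 2 \<and> (\<forall>n. c n \<in> sector \<theta>)) \<and>
     (\<exists>lam\<ge>2. \<exists>C>0. \<forall>m\<ge>1.
        (\<Sum>k=m..2*m. cmod (c (k + 1) - c k)) \<le>
          C / real m * (\<Sum>k=nat \<lfloor>inverse lam * real m\<rfloor>..nat \<lfloor>lam * real m\<rfloor>. cmod (c k)))}"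

end

theory Submission
  imports Defs
begin


text \<open>
  The theorem rests on two facts about a block \<open>S\<^sub>m f - S\<^sub>n f\<close> with \<open>n \<le> m \<le> 2n\<close>, whose
  coefficients are those of \<open>f\<close> at the frequencies \<open>n < \<bar>k\<bar> \<le> m\<close>. Its norm is bounded above by
  \<open>ln n\<close> times the size and variation of the coefficients (Abel summation and the logarithmic size of
  Dirichlet-type kernels, \<open>L_norm_annulus_le\<close>), and bounded below, for \<open>m = 2n\<close>, by sums of the coefficients with
  weights \<open>1 / k\<close> (a Hardy-type inequality, \<open>hilbert_sum_sector_le\<close>). The mean value condition links
  variation and size: the variation over \<open>{n..2n}\<close> is at most a constant times the average of
  \<open>\<bar>c k\<bar>\<close> over a window of indices comparable with \<open>n\<close>. Both halves therefore go through the claim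
  that the window sum times \<open>ln n\<close> is \<open>O(n \<psi> n)\<close>; by the doubling condition it does not
  matter at which point of a window \<open>\<psi>\<close> is evaluated.

  Sufficiency. The remainder \<open>f - S\<^sub>n f\<close> is compared with the best approximation through the
  de la Vallee Poussin mean of \<open>S\<^sub>n, \<dots>, S\<^sub>2\<^sub>n\<^sub>-\<^sub>1\<close>, which is bounded on integrable functions. This
  leaves \<open>4 E\<^sub>n(f)\<close> plus the largest norm of a block \<open>S\<^sub>m f - S\<^sub>n f\<close>
  (\<open>L_norm_remainder_le_best_approx\<close>). A pointwise bound \<open>c n = O(\<psi> n / ln n)\<close> bounds the window
  sums (\<open>window_bound_of_coeff_bound\<close>), hence the variation, hence the blocks.

  Necessity. The bound for \<open>E\<^sub>n(f)\<close> is immediate. The blocks from \<open>n\<close> to \<open>2n\<close> have norm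
  \<open>O(\<psi> n)\<close>. Testing them against a sawtooth, and using that the coefficients lie in a sector
  of half-angle less than \<open>\<pi>/2\<close>, gives \<open>(\<Sum>k=1..n. \<bar>c (n + k)\<bar> / k) = O(\<psi> n)\<close> for all large \<open>n\<close>.
  Summed over \<open>n\<close>, this bounds the window sums (\<open>window_bound_of_hilbert_sums\<close>): every coefficient in
  the window collects a full harmonic sum, which is the logarithm. The mean value condition passes
  from the average over a window to the single coefficient (\<open>coeff_bound_of_window_bound\<close>).
\<close>

section \<open>Trigonometric sums over finite sets of frequencies\<close>

definition trig_sum :: "int set \<Rightarrow> (int \<Rightarrow> complex) \<Rightarrow> real \<Rightarrow> complex" where
  "trig_sum K a x = (\<Sum>k\<in>K. a k * cis (of_int k * x))"

lemma trig_poly_eq_trig_sum: "trig_poly n c = trig_sum {- int n..int n} c"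
  unfolding trig_poly_def trig_sum_def cis_conv_exp
  by (intro ext sum.cong refl) (simp add: mult_ac)

lemma fourier_coeff_eq_cis:
  "fourier_coeff f k =
     1 / (2 * of_real pi) * (LINT x:{-pi..pi}|lebesgue. f x * cis (- (of_int k * x)))"
  unfolding fourier_coeff_def cis_conv_exp by (simp add: mult_ac)

lemma continuous_on_cis_linear [continuous_intros]: "continuous_on A (\<lambda>x. cis (c * x))"
  unfolding cis_conv_exp by (intro continuous_intros)

lemma continuous_on_trig_sum [continuous_intros]: "continuous_on A (trig_sum K a)"
  unfolding trig_sum_def by (intro continuous_intros)

lemma absolutely_integrable_trig_sum [simp, intro]: "trig_sum K a absolutely_integrable_on {u..v}"
  by (intro absolutely_integrable_continuous_real continuous_intros)

lemma absolutely_integrable_mult_cis: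
  assumes "g absolutely_integrable_on {u..v::real}"
  shows "(\<lambda>x. g x * cis (c * x)) absolutely_integrable_on {u..v}"
proof -
  have "(\<lambda>x. cis (c * x) * g x) absolutely_integrable_on {u..v}"
  proof (rule absolutely_integrable_bounded_measurable_product[OF bilinear_times])
    show "(\<lambda>x. cis (c * x)) \<in> borel_measurable (lebesgue_on {u..v})"
      by (intro continuous_imp_measurable_on_sets_lebesgue continuous_intros) auto
    show "bounded ((\<lambda>x. cis (c * x)) ` {u..v})"
      by (intro boundedI[of _ 1]) auto
  qed (use assms in auto)
  then show ?thesis by (simp add: mult.commute)
qed

section \<open>The integral norm\<close>

lemma L_norm_nonneg: "0 \<le> L_norm g"
  unfolding L_norm_def set_lebesgue_integral_def by (intro integral_nonneg_AE) auto

lemma L_norm_triangle: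
  assumes "g absolutely_integrable_on {-pi..pi}" "h absolutely_integrable_on {-pi..pi}"
  shows "L_norm (\<lambda>x. g x + h x) \<le> L_norm g + L_norm h"
proof -
  have "L_norm (\<lambda>x. g x + h x) \<le> (LINT x:{-pi..pi}|lebesgue. cmod (g x) + cmod (h x))"
    unfolding L_norm_def
    by (intro set_integral_mono set_integral_add set_integrable_norm assms norm_triangle_ineq)
  also have "\<dots> = L_norm g + L_norm h"
    unfolding L_norm_def by (intro set_integral_add set_integrable_norm assms)
  finally show ?thesis .
qed

lemma L_norm_mult_left: "L_norm (\<lambda>x. c * g x) = cmod c * L_norm g"
  unfolding L_norm_def by (simp add: norm_mult)

lemma L_norm_diff:
  assumes "g absolutely_integrable_on {-pi..pi}" "h absolutely_integrable_on {-pi..pi}"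
  shows "L_norm (\<lambda>x. g x - h x) \<le> L_norm g + L_norm h"
  using L_norm_triangle[OF assms(1) set_integrable_mult_right[OF assms(2), of "-1"]]
    L_norm_mult_left[of "-1" h] by simp

lemma L_norm_sum:
  assumes "finite I" "\<And>i. i \<in> I \<Longrightarrow> g i absolutely_integrable_on {-pi..pi}"
  shows "L_norm (\<lambda>x. \<Sum>i\<in>I. g i x) \<le> (\<Sum>i\<in>I. L_norm (g i))"
  using assms
proof (induction I rule: finite_induct)
  case empty
  then show ?case by (simp add: L_norm_def)
next
  case (insert i I)
  have "L_norm (\<lambda>x. g i x + (\<Sum>i\<in>I. g i x)) \<le> L_norm (g i) + L_norm (\<lambda>x. \<Sum>i\<in>I. g i x)"
    by (intro L_norm_triangle absolutely_integrable_sum insert) (use insert in auto)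
  then show ?case using insert by force
qed

lemma L_norm_mono:
  assumes "g absolutely_integrable_on {-pi..pi}" "h absolutely_integrable_on {-pi..pi}"
    and "\<And>x. x \<in> {-pi..pi} \<Longrightarrow> cmod (g x) \<le> h x"
  shows "L_norm g \<le> (LINT x:{-pi..pi}|lebesgue. h x)"
  unfolding L_norm_def by (intro set_integral_mono set_integrable_norm assms)

section \<open>Fourier coefficients and orthogonality\<close>

lemma norm_fourier_coeff_le:
  assumes "g absolutely_integrable_on {-pi..pi}"
  shows "cmod (fourier_coeff g k) \<le> L_norm g / (2 * pi)"
proof -
  have "cmod (LINT x:{-pi..pi}|lebesgue. g x * cis (- (of_int k * x))) \<le> 
     (LINT x:{-pi..pi}|lebesgue. cmod (g x * cis (- (of_int k * x))))"
    using absolutely_integrable_mult_cis[OF assms, of "- of_int k"] 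
    by (intro set_integral_norm_bound) simp
  then show ?thesis
    unfolding fourier_coeff_eq_cis L_norm_def
    by (simp add: norm_mult norm_divide divide_simps)
qed

lemma fourier_coeff_diff:
  assumes "g absolutely_integrable_on {-pi..pi}" "h absolutely_integrable_on {-pi..pi}"
  shows "fourier_coeff (\<lambda>x. g x - h x) k = fourier_coeff g k - fourier_coeff h k"
  using absolutely_integrable_mult_cis[OF assms(1), of "- of_int k"] 
    absolutely_integrable_mult_cis[OF assms(2), of "- of_int k"] 
  unfolding fourier_coeff_eq_cis by (simp add: algebra_simps)

lemma has_vector_derivative_cis_linear:
  "((\<lambda>x. cis (c * x)) has_vector_derivative \<i> * of_real c * cis (c * x)) (at x within A)"
proof -
  have "((\<lambda>z. exp (\<i> * of_real c * z)) has_field_derivative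
      \<i> * of_real c * exp (\<i> * of_real c * of_real x)) (at (of_real x))"
    by (auto intro!: derivative_eq_intros)
  from has_vector_derivative_real_field[OF this] show ?thesis
    by (simp add: cis_conv_exp mult.assoc)
qed

lemma cis_int_mult_minus_pi: "cis (of_int k * (- pi)) = cis (of_int k * pi)"
proof -
  have "sin (of_int k * pi) = 0"
    unfolding sin_zero_iff_int2 by auto
  then show ?thesis by (simp add: complex_eq_iff)
qed

lemma has_integral_cis_int:
  "((\<lambda>x. cis (of_int k * x)) has_integral (if k = 0 then 2 * of_real pi else 0)) {-pi..pi}"
proof (cases "k = 0")
  case True
  then show ?thesis
    using has_integral_const_real[of "1::complex" "-pi" pi] by (simp add: scaleR_conv_of_real)
next
  case False
  have "((\<lambda>x. cis (of_int k * x)) has_integral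
     (cis (of_int k * pi) / (\<i> * of_int k) - cis (of_int k * (-pi)) / (\<i> * of_int k))) {-pi..pi}"
  proof (rule fundamental_theorem_of_calculus)
    show "((\<lambda>x. cis (of_int k * x) / (\<i> * of_int k)) has_vector_derivative cis (of_int k * x))
        (at x within {-pi..pi})" for x
      using has_vector_derivative_divide[OF has_vector_derivative_cis_linear[of "of_int k" x "{-pi..pi}"],
          of "\<i> * of_int k"] False
      by simp
  qed auto
  then show ?thesis using False by (simp only: cis_int_mult_minus_pi) simp
qed

lemma set_integral_trig_sum:
  assumes "finite K"
  shows "(LINT x:{-pi..pi}|lebesgue. trig_sum K a x) = (if 0 \<in> K then 2 * of_real pi * a 0 else 0)"
proof -
  have "(trig_sum K a has_integral (\<Sum>k\<in>K. a k * (if k = 0 then 2 * of_real pi else 0))) {-pi..pi}"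
    unfolding trig_sum_def
    by (intro has_integral_sum has_integral_mult_right has_integral_cis_int assms)
  moreover have "(\<Sum>k\<in>K. a k * (if k = 0 then 2 * of_real pi else 0)) =
     (if 0 \<in> K then 2 * of_real pi * a 0 else 0)"
    using assms by (simp add: sum.delta if_distrib mult.commute cong: if_cong)
  ultimately show ?thesis
    by (simp add: set_lebesgue_integral_eq_integral(2)[OF absolutely_integrable_trig_sum] integral_unique)
qed

lemma trig_sum_mult_cis:
  "trig_sum K a x * cis (of_int p * x) = trig_sum ((\<lambda>k. k + p) ` K) (\<lambda>k. a (k - p)) x"
  unfolding trig_sum_def sum_distrib_right
  by (subst sum.reindex) (auto simp: inj_on_def cis_mult mult.assoc distrib_right)

lemma fourier_coeff_trig_sum:
  assumes "finite K"
  shows "fourier_coeff (trig_sum K a) k = (if k \<in> K then a k else 0)"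
proof -
  have "0 \<in> (\<lambda>j. j + - k) ` K \<longleftrightarrow> k \<in> K" by force
  moreover have "(LINT x:{-pi..pi}|lebesgue. trig_sum K a x * cis (- (of_int k * x)))
     = (LINT x:{-pi..pi}|lebesgue. trig_sum ((\<lambda>j. j + - k) ` K) (\<lambda>j. a (j - - k)) x)"
    using trig_sum_mult_cis[of K a _ "-k"] by simp
  ultimately show ?thesis
    unfolding fourier_coeff_eq_cis using assms by (simp add: set_integral_trig_sum)
qed

section \<open>Norms of blocks of characters\<close>

text \<open>
  The sine is concave on \<open>[0, \<pi>/2]\<close>, so its graph lies above the chord from the origin to
  \<open>(\<pi>/2, 1)\<close>.
\<close>

lemma sine_ge_chord:
  fixes y :: real
  assumes "0 \<le> y" "y \<le> pi / 2"
  shows "2 * y / pi \<le> sin y"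
proof -
  have "concave_on {0..pi/2} sin"
  proof (rule f''_le0_imp_concave)
    show "(sin has_real_derivative cos x) (at x)" for x :: real
      by (auto intro!: derivative_eq_intros)
    show "(cos has_real_derivative - sin x) (at x)" for x :: real
      by (auto intro!: derivative_eq_intros)
    show "- sin x \<le> 0" if "x \<in> {0..pi/2}" for x :: real
      using that by (simp add: sin_ge_zero)
  qed auto
  from concave_onD[OF this, of "2 * y / pi" 0 "pi / 2"] assms
  show ?thesis by (simp add: field_simps)
qed

lemma norm_cis_minus_one_ge:
  assumes "\<bar>x\<bar> \<le> pi"
  shows "2 * \<bar>x\<bar> / pi \<le> cmod (cis x - 1)"
proof -
  have *: "cmod (cis x - 1) = 2 * sin (\<bar>x\<bar> / 2)"
  proof -
    have "cmod (cis x - 1) = cmod (cis (x/2) - cis (- (x/2)))"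
      using norm_mult[of "cis (x/2)" "cis (x/2) - cis (- (x/2))"]
      by (simp add: cis_mult right_diff_distrib)
    also have "cis (x/2) - cis (- (x/2)) = 2 * \<i> * of_real (sin (x/2))"
      by (simp add: complex_eq_iff)
    also have "cmod \<dots> = 2 * \<bar>sin (x/2)\<bar>"
      by (simp add: norm_mult)
    also have "\<bar>sin (x/2)\<bar> = sin (\<bar>x\<bar> / 2)"
      using sin_ge_zero[of "\<bar>x\<bar>/2"] assms by (cases "x \<ge> 0") (auto simp: abs_if)
    finally show ?thesis .
  qed
  show ?thesis
    using sine_ge_chord[of "\<bar>x\<bar> / 2"] assms unfolding * by simp
qed

definition cis_block :: "nat \<Rightarrow> nat \<Rightarrow> real \<Rightarrow> complex" where
  "cis_block n m x = (\<Sum>j\<in>{n<..m}. cis (of_nat j * x))"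

text \<open>
  Two bounds hold for a sum of \<open>m - n\<close> consecutive characters \<open>e\<^sup>i\<^sup>j\<^sup>x\<close>: it has \<open>m - n\<close> terms of
  modulus \<open>1\<close>, and multiplication by \<open>e\<^sup>i\<^sup>x - 1\<close>, whose modulus is at least \<open>2\<bar>x\<bar> / \<pi>\<close>, makes it
  telescope to two terms. Adding the two estimates with suitable weights merges them into one
  denominator, so that the kernel can be integrated over the whole period in one stroke.
\<close>

lemma norm_cis_block_le:
  assumes "n < m" "\<bar>x\<bar> \<le> pi"
  shows "cmod (cis_block n m x) \<le> 2 * pi / (pi / real (m - n) + \<bar>x\<bar>)"
proof -
  define S where "S = cis_block n m x"
  have "cmod S \<le> (\<Sum>j\<in>{n<..m}. 1)"
    unfolding S_def cis_block_def by (intro sum_norm_le) auto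
  then have "cmod S / real (m - n) \<le> 1" using assms(1) by simp
  then have 1: "cmod S * (pi / real (m - n)) \<le> pi"
    using mult_left_mono[of "cmod S / real (m - n)" 1 pi] by (simp add: mult.commute)
  have "(cis x - 1) * cis_block n m x = cis (of_nat (Suc m) * x) - cis (of_nat (Suc n) * x)"
    if "n \<le> m" for m
    using that
  proof (induction m rule: dec_induct)
    case base
    then show ?case by (simp add: cis_block_def)
  next
    case (step m)
    have "cis_block n (Suc m) x = cis_block n m x + cis (of_nat (Suc m) * x)"
    proof -
      have "{n<..Suc m} = insert (Suc m) {n<..m}" using step by auto
      then show ?thesis by (simp add: cis_block_def)
    qed
    then show ?case using step(3) by (simp add: algebra_simps cis_mult)
  qed
  then have "cmod (cis x - 1) * cmod S = cmod (cis (of_nat (Suc m) * x) - cis (of_nat (Suc n) * x))"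
    using assms by (simp add: S_def flip: norm_mult)
  also have "\<dots> \<le> 2" using norm_triangle_ineq4[of "cis (of_nat (Suc m) * x)" "cis (of_nat (Suc n) * x)"] by simp
  finally have "cmod (cis x - 1) * cmod S \<le> 2" .
  then have "2 * \<bar>x\<bar> / pi * cmod S \<le> 2"
    using mult_right_mono[OF norm_cis_minus_one_ge[OF assms(2)] norm_ge_zero[of S]] by linarith
  then have 2: "cmod S * \<bar>x\<bar> \<le> pi" by (simp add: field_simps)
  have "cmod S * (pi / real (m - n) + \<bar>x\<bar>) \<le> 2 * pi"
    using 1 2 by (simp add: distrib_left)
  moreover have "pi / real (m - n) + \<bar>x\<bar> > 0"
    using assms by (intro add_pos_nonneg) auto
  ultimately show ?thesis by (simp add: S_def pos_le_divide_eq)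
qed

lemma has_integral_inverse_abs_plus:
  fixes a r :: real
  assumes "0 < a" "0 < r"
  shows "((\<lambda>x. 1 / (a + \<bar>x\<bar>)) has_integral 2 * ln ((a + r) / a)) {-r..r}"
proof -
  have "((\<lambda>x. 1 / (a + \<bar>x\<bar>)) has_integral (ln (a + r) - ln (a + 0))) {0..r}"
  proof (rule fundamental_theorem_of_calculus)
    show "((\<lambda>x. ln (a + x)) has_vector_derivative 1 / (a + \<bar>x\<bar>)) (at x within {0..r})"
      if "x \<in> {0..r}" for x
      unfolding has_real_derivative_iff_has_vector_derivative[symmetric]
      using that assms by (auto intro!: derivative_eq_intros)
  qed (use assms in auto)
  moreover have "((\<lambda>x. 1 / (a + \<bar>x\<bar>)) has_integral (- ln (a - 0) - - ln (a - - r))) {-r..0}"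
  proof (rule fundamental_theorem_of_calculus)
    show "((\<lambda>x. - ln (a - x)) has_vector_derivative 1 / (a + \<bar>x\<bar>)) (at x within {-r..0})"
      if "x \<in> {-r..0}" for x
      unfolding has_real_derivative_iff_has_vector_derivative[symmetric]
      using that assms by (auto intro!: derivative_eq_intros)
  qed (use assms in auto)
  ultimately have "((\<lambda>x. 1 / (a + \<bar>x\<bar>)) has_integral
      (- ln (a - 0) - - ln (a - - r)) + (ln (a + r) - ln (a + 0))) {-r..r}"
    using assms by (intro has_integral_combine[of "-r" 0 r]) auto
  then show ?thesis using assms by (simp add: ln_div)
qed

text \<open>
  The logarithmic growth of the Lebesgue constants. The sign \<open>s\<close> lets the same estimate
  serve blocks of positive and of negative frequencies.
\<close>

lemma L_norm_cis_block_le: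
  assumes "\<bar>s\<bar> = 1"
  shows "L_norm (\<lambda>x. cis_block n m (s * x)) \<le> 4 * pi * ln (real (m - n) + 1)"
proof (cases "n < m")
  case True
  let ?h = "\<lambda>x. 2 * pi * (1 / (pi / real (m - n) + \<bar>x\<bar>))"
  have pos: "pi / real (m - n) + \<bar>x\<bar> > 0" for x
    using True by (intro add_pos_nonneg) auto
  have "continuous_on {-pi..pi} ?h"
    using pos by (intro continuous_intros) (auto simp: less_imp_neq[symmetric])
  then have h: "?h absolutely_integrable_on {-pi..pi}"
    by (rule absolutely_integrable_continuous_real)
  have "L_norm (\<lambda>x. cis_block n m (s * x)) \<le> (LINT x:{-pi..pi}|lebesgue. ?h x)"
  proof (rule L_norm_mono[OF _ h])
    show "(\<lambda>x. cis_block n m (s * x)) absolutely_integrable_on {-pi..pi}"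
      unfolding cis_block_def mult.assoc[symmetric]
      by (intro absolutely_integrable_continuous_real continuous_intros)
    show "cmod (cis_block n m (s * x)) \<le> ?h x" if "x \<in> {-pi..pi}" for x
      using norm_cis_block_le[OF True, of "s * x"] that assms by (auto simp: abs_mult)
  qed
  also have "\<dots> = integral {-pi..pi} ?h"
    by (rule set_lebesgue_integral_eq_integral(2)[OF h])
  also have "\<dots> = 2 * pi * (2 * ln ((pi / real (m - n) + pi) / (pi / real (m - n))))"
    using True by (intro integral_unique has_integral_mult_right has_integral_inverse_abs_plus) auto
  also have "(pi / real (m - n) + pi) / (pi / real (m - n)) = real (m - n) + 1"
    using True by (simp add: field_simps)
  finally show ?thesis by simp
next
  case False
  then show ?thesis by (simp add: cis_block_def L_norm_def)
qed



section \<open>A Hardy-type inequality for trigonometric sums\<close>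

text \<open>
  The two branches of the sawtooth \<open>x - \<pi> sgn x\<close>. In the sum of the two integrals the
  terms with \<open>1 / k\<^sup>2\<close> cancel, and what remains is a multiple of \<open>1 / k\<close>.
\<close>

lemma integral_saw_cis:
  fixes k :: int
  assumes "k \<noteq> 0"
  shows "((\<lambda>x. of_real (x + pi) * cis (of_int k * x)) has_integral
      pi / (\<i> * of_int k) + (1 - cis (pi * of_int k)) / (of_int k)\<^sup>2) {-pi..0}"
    and "((\<lambda>x. of_real (x - pi) * cis (of_int k * x)) has_integral
      pi / (\<i> * of_int k) - (1 - cis (pi * of_int k)) / (of_int k)\<^sup>2) {0..pi}"
proof -
  \<comment> \<open>An antiderivative, found by integration by parts.\<close>
  define F where "F = (\<lambda>b x. of_real (x + b) * cis (of_int k * x) / (\<i> * of_int k)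
     + cis (of_int k * x) / (of_int k)\<^sup>2)"
  have F: "(F b has_vector_derivative of_real (x + b) * cis (of_int k * x)) (at x within A)" for b x A
  proof -
    have "((\<lambda>z. (z + of_real b) * exp (\<i> * of_int k * z) / (\<i> * of_int k)
         + exp (\<i> * of_int k * z) / (of_int k)\<^sup>2)
       has_field_derivative (of_real x + of_real b) * exp (\<i> * of_int k * of_real x)) (at (of_real x))"
      using assms by (auto intro!: derivative_eq_intros simp: field_simps power2_eq_square)
    from has_vector_derivative_real_field[OF this] show ?thesis
      by (simp add: F_def cis_conv_exp mult.assoc)
  qed
  have cis_eq: "cis (of_int k * (-pi)) = cis (pi * of_int k)"
    unfolding cis_int_mult_minus_pi by (simp add: mult.commute)
  have "((\<lambda>x. of_real (x + pi) * cis (of_int k * x)) has_integral (F pi 0 - F pi (-pi))) {-pi..0}"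
    by (rule fundamental_theorem_of_calculus[OF _ F]) simp
  then show "((\<lambda>x. of_real (x + pi) * cis (of_int k * x)) has_integral
      pi / (\<i> * of_int k) + (1 - cis (pi * of_int k)) / (of_int k)\<^sup>2) {-pi..0}"
    using cis_eq by (simp add: F_def diff_divide_distrib algebra_simps)
  have "((\<lambda>x. of_real (x + (-pi)) * cis (of_int k * x)) has_integral (F (-pi) pi - F (-pi) 0)) {0..pi}"
    by (rule fundamental_theorem_of_calculus[OF _ F]) simp
  then show "((\<lambda>x. of_real (x - pi) * cis (of_int k * x)) has_integral
      pi / (\<i> * of_int k) - (1 - cis (pi * of_int k)) / (of_int k)\<^sup>2) {0..pi}"
    using cis_eq by (simp add: F_def diff_divide_distrib algebra_simps)
qed

text \<open>
  A Hardy-type inequality. The sawtooth is bounded by \<open>\<pi>\<close>, while its Fourier coefficients are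
  multiples of \<open>1 / k\<close>; pairing it with the trigonometric sum, after shifting the frequency \<open>p\<close> to
  the origin, produces the weighted sum of the coefficients exactly. This is how a bound for an
  integral of a modulus becomes a bound for coefficients with a logarithmic gain.
\<close>

lemma norm_hilbert_sum_le:
  assumes K: "finite K" "p \<notin> K"
  shows "cmod (\<Sum>k\<in>K. a k / of_int (k - p)) \<le> L_norm (trig_sum K a) / 2"
proof -
  define g where "g = (\<lambda>x. \<Sum>k\<in>K. a k * cis (of_int (k - p) * x))"
  have cg: "continuous_on A g" for A
    unfolding g_def by (intro continuous_intros)
  have "g x = trig_sum K a x * cis (- of_int p * x)" for x
    unfolding g_def trig_sum_def sum_distrib_right
    by (intro sum.cong refl) (simp add: cis_mult algebra_simps)
  then have norm_g: "cmod (g x) = cmod (trig_sum K a x)" for x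
    by (simp add: norm_mult)
  \<comment> \<open>The contribution that the two halves of the period make with opposite signs.\<close>
  define d where "d = (\<lambda>k. (1 - cis (pi * of_int (k - p))) / (of_int (k - p))\<^sup>2)"
  define I1 where "I1 = (\<Sum>k\<in>K. a k * (pi / (\<i> * of_int (k - p)) + d k))"
  define I2 where "I2 = (\<Sum>k\<in>K. a k * (pi / (\<i> * of_int (k - p)) - d k))"
  have ne: "k - p \<noteq> 0" if "k \<in> K" for k using K that by auto
  have I1: "((\<lambda>x. of_real (x + pi) * g x) has_integral I1) {-pi..0}"
    unfolding I1_def g_def d_def sum_distrib_left mult.left_commute[of _ "a _"]
    by (intro has_integral_sum has_integral_mult_right integral_saw_cis K ne)
  have I2: "((\<lambda>x. of_real (x - pi) * g x) has_integral I2) {0..pi}"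
    unfolding I2_def g_def d_def sum_distrib_left mult.left_commute[of _ "a _"]
    by (intro has_integral_sum has_integral_mult_right integral_saw_cis K ne)
  have int: "(\<lambda>x. pi * cmod (g x)) integrable_on {u..v}" for u v
    by (intro integrable_continuous_real continuous_intros cg)
  have "cmod I1 \<le> integral {-pi..0} (\<lambda>x. pi * cmod (g x))"
    unfolding integral_unique[OF I1, symmetric]
    by (rule integral_norm_bound_integral[OF has_integral_integrable[OF I1] int])
       (auto simp: norm_mult mult_right_mono simp flip: of_real_add)
  moreover have "cmod I2 \<le> integral {0..pi} (\<lambda>x. pi * cmod (g x))"
    unfolding integral_unique[OF I2, symmetric]
    by (rule integral_norm_bound_integral[OF has_integral_integrable[OF I2] int])
       (auto simp: norm_mult mult_right_mono simp flip: of_real_diff)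
  ultimately have "cmod (I1 + I2) \<le> integral {-pi..pi} (\<lambda>x. pi * cmod (g x))"
    using Henstock_Kurzweil_Integration.integral_combine[OF _ _ int, of "-pi" 0 pi]
      norm_triangle_ineq[of I1 I2] by simp
  also have "\<dots> = pi * L_norm (trig_sum K a)"
  proof -
    have "L_norm (trig_sum K a) = integral {-pi..pi} (\<lambda>x. cmod (trig_sum K a x))"
      unfolding L_norm_def
      by (intro set_lebesgue_integral_eq_integral set_integrable_norm absolutely_integrable_trig_sum)
    then show ?thesis by (simp add: norm_g)
  qed
  also have "I1 + I2 = (2 * pi / \<i>) * (\<Sum>k\<in>K. a k / of_int (k - p))"
    unfolding I1_def I2_def sum.distrib[symmetric] sum_distrib_left
  proof (intro sum.cong refl)
    have "b * (q / (\<i> * r) + t) + b * (q / (\<i> * r) - t) = (2 * q / \<i>) * (b / r)" for b q r t :: complex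
      by (cases "r = 0") (simp_all add: field_simps)
    then show "a k * (pi / (\<i> * of_int (k - p)) + d k) + a k * (pi / (\<i> * of_int (k - p)) - d k)
        = (2 * pi / \<i>) * (a k / of_int (k - p))" for k
      by simp
  qed
  finally show ?thesis by (simp add: norm_mult norm_divide)
qed

section \<open>Abel summation\<close>

lemma abel_summation_cis:
  assumes "n \<le> m"
  shows "(\<Sum>k\<in>{n<..m}. c k * cis (of_nat k * y)) =
    c m * cis_block n m y - (\<Sum>k\<in>{n..<m}. (c (k + 1) - c k) * cis_block n k y)"
  using assms
proof (induction m rule: dec_induct)
  case base
  then show ?case by (simp add: cis_block_def)
next
  case (step m)
  have *: "{n<..Suc m} = insert (Suc m) {n<..m}" "{n..<Suc m} = insert m {n..<m}"
    using step by auto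
  have "cis_block n (Suc m) y = cis_block n m y + cis (of_nat (Suc m) * y)"
    by (simp add: cis_block_def *)
  then show ?case using step(3) by (simp add: * algebra_simps)
qed

text \<open>
  Abel summation trades coefficients for their differences against blocks of consecutive
  characters, and every such block costs at most a logarithm in norm.
\<close>

lemma L_norm_cis_sum_le:
  assumes "n \<le> m" "\<bar>s\<bar> = 1"
  shows "L_norm (\<lambda>x. \<Sum>k\<in>{n<..m}. c k * cis (of_nat k * (s * x)))
    \<le> 4 * pi * ln (real (m - n) + 1) * (cmod (c m) + (\<Sum>k\<in>{n..<m}. cmod (c (k + 1) - c k)))"
proof -
  let ?B = "\<lambda>k x. cis_block n k (s * x)" and ?M = "4 * pi * ln (real (m - n) + 1)"
  have int: "?B k absolutely_integrable_on {-pi..pi}" for k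
    unfolding cis_block_def mult.assoc[symmetric]
    by (intro absolutely_integrable_continuous_real continuous_intros)
  have B: "L_norm (?B k) \<le> ?M" if "k \<le> m" for k
  proof -
    have "ln (real (k - n) + 1) \<le> ln (real (m - n) + 1)"
      using that by (simp add: diff_le_mono)
    then show ?thesis
      using L_norm_cis_block_le[OF assms(2), of n k] by (simp add: order_trans)
  qed
  have "L_norm (\<lambda>x. \<Sum>k\<in>{n<..m}. c k * cis (of_nat k * (s * x)))
      = L_norm (\<lambda>x. c m * ?B m x - (\<Sum>k\<in>{n..<m}. (c (k + 1) - c k) * ?B k x))"
    by (simp only: abel_summation_cis[OF assms(1)])
  also have "\<dots> \<le> L_norm (\<lambda>x. c m * ?B m x) + L_norm (\<lambda>x. \<Sum>k\<in>{n..<m}. (c (k + 1) - c k) * ?B k x)"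
    by (intro L_norm_diff absolutely_integrable_sum set_integrable_mult_right int) auto
  also have "L_norm (\<lambda>x. \<Sum>k\<in>{n..<m}. (c (k + 1) - c k) * ?B k x)
      \<le> (\<Sum>k\<in>{n..<m}. L_norm (\<lambda>x. (c (k + 1) - c k) * ?B k x))"
    by (intro L_norm_sum set_integrable_mult_right int) auto
  also have "L_norm (\<lambda>x. c m * ?B m x) + (\<Sum>k\<in>{n..<m}. L_norm (\<lambda>x. (c (k + 1) - c k) * ?B k x))
     \<le> cmod (c m) * ?M + (\<Sum>k\<in>{n..<m}. cmod (c (k + 1) - c k) * ?M)"
    unfolding L_norm_mult_left by (intro add_mono sum_mono mult_left_mono B) auto
  finally show ?thesis by (simp add: algebra_simps sum_distrib_left)
qed

section \<open>Fejer and de la Vallee Poussin means\<close>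

text \<open>
  Fejer's identity, free of the triangular weights: enlarging the square \<open>{0..<n}\<^sup>2\<close> by one row and
  one column adds each difference between \<open>-n\<close> and \<open>n\<close> exactly once.
\<close>

lemma sum_differences_eq_sum_symmetric:
  fixes h :: "int \<Rightarrow> 'a::ab_group_add"
  shows "(\<Sum>j<n. \<Sum>l<n. h (int j - int l)) = (\<Sum>m<n. \<Sum>k\<in>{- int m..int m}. h k)"
proof (induction n)
  case (Suc n)
  have "(\<Sum>k\<in>{- int n..int n}. h k) = h 0 + (\<Sum>k\<in>{1..int n}. h k) + (\<Sum>k\<in>{- int n..-1}. h k)"
  proof -
    have *: "{- int n..int n} = insert 0 ({1..int n} \<union> {- int n..-1})" by auto
    show ?thesis unfolding * by (subst sum.insert; (subst sum.union_disjoint)?) (auto simp: add_ac)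
  qed
  moreover have "(\<Sum>l<n. h (int n - int l)) = (\<Sum>k\<in>{1..int n}. h k)"
    by (rule sum.reindex_bij_witness[of _ "\<lambda>k. nat (int n - k)" "\<lambda>l. int n - int l"]) auto
  moreover have "(\<Sum>j<n. h (int j - int n)) = (\<Sum>k\<in>{- int n..-1}. h k)"
    by (rule sum.reindex_bij_witness[of _ "\<lambda>k. nat (int n + k)" "\<lambda>l. int l - int n"]) auto
  ultimately show ?case using Suc by (simp add: sum.distrib algebra_simps)
qed simp

text \<open>
  The reason why the Fejer kernel is nonnegative.
\<close>

lemma sum_dirichlet_kernels_eq:
  "(\<Sum>m<n. \<Sum>k\<in>{- int m..int m}. cis (of_int k * t)) = of_real ((cmod (\<Sum>j<n. cis (real j * t)))\<^sup>2)"
proof -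
  have "(\<Sum>m<n. \<Sum>k\<in>{- int m..int m}. cis (of_int k * t)) =
      (\<Sum>j<n. \<Sum>l<n. cis (real j * t) * cnj (cis (real l * t)))"
    by (simp add: cis_cnj cis_mult algebra_simps flip: sum_differences_eq_sum_symmetric)
  also have "\<dots> = (\<Sum>j<n. cis (real j * t)) * cnj (\<Sum>j<n. cis (real j * t))"
    by (simp add: sum_product)
  finally show ?thesis unfolding complex_norm_square .
qed

lemma set_integral_finite_sum:
  fixes g :: "'i \<Rightarrow> 'a \<Rightarrow> 'b::{banach, second_countable_topology}"
  assumes "\<And>i. i \<in> I \<Longrightarrow> set_integrable M A (g i)"
  shows "(LINT x:A|M. \<Sum>i\<in>I. g i x) = (\<Sum>i\<in>I. LINT x:A|M. g i x)"
  using assms unfolding set_integrable_def set_lebesgue_integral_def scaleR_sum_right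
  by (rule Bochner_Integration.integral_sum)

lemma sum_partial_sums_eq_integral:
  assumes g: "g absolutely_integrable_on {-pi..pi}"
  shows "2 * pi * (\<Sum>m<n. fourier_partial_sum m g x) =
      (LINT y:{-pi..pi}|lebesgue. g y * of_real ((cmod (\<Sum>j<n. cis (real j * (x - y))))\<^sup>2))"
proof -
  have int: "(\<lambda>y. cis (of_int k * x) * (g y * cis (- (of_int k * y)))) absolutely_integrable_on {-pi..pi}"
    for k
    using absolutely_integrable_mult_cis[OF g, of "- of_int k"] by (intro set_integrable_mult_right) simp
  have "2 * pi * (\<Sum>m<n. fourier_partial_sum m g x) =
      (\<Sum>m<n. \<Sum>k\<in>{- int m..int m}.
        (LINT y:{-pi..pi}|lebesgue. cis (of_int k * x) * (g y * cis (- (of_int k * y)))))"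
    unfolding fourier_partial_sum_def trig_poly_eq_trig_sum trig_sum_def fourier_coeff_eq_cis
      sum_distrib_left set_integral_mult_right
    by (intro sum.cong refl) simp
  also have "\<dots> = (LINT y:{-pi..pi}|lebesgue.
      (\<Sum>m<n. \<Sum>k\<in>{- int m..int m}. cis (of_int k * x) * (g y * cis (- (of_int k * y)))))"
    by (simp add: set_integral_finite_sum absolutely_integrable_sum int)
  also have "(\<lambda>y. \<Sum>m<n. \<Sum>k\<in>{- int m..int m}. cis (of_int k * x) * (g y * cis (- (of_int k * y))))
     = (\<lambda>y. g y * (\<Sum>m<n. \<Sum>k\<in>{- int m..int m}. cis (of_int k * (x - y))))"
    unfolding sum_distrib_left
    by (intro ext sum.cong refl) (simp add: cis_mult right_diff_distrib mult.left_commute[of _ "g _"])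
  finally show ?thesis unfolding sum_dirichlet_kernels_eq .
qed


text \<open>
  Fejer means do not increase the norm. Since the Fejer kernel is nonnegative, the mean of \<open>g\<close> is
  dominated at every point by the mean of \<open>\<bar>g\<bar>\<close>. That mean is a trigonometric polynomial, whose
  integral is read off from its constant term; no interchange of integrals is involved.
\<close>

lemma L_norm_sum_partial_sums_le:
  assumes g: "g absolutely_integrable_on {-pi..pi}"
  shows "L_norm (\<lambda>x. \<Sum>m<n. fourier_partial_sum m g x) \<le> real n * L_norm g"
proof -
  let ?G = "\<lambda>x. complex_of_real (cmod (g x))"
  let ?F = "\<lambda>x y. (cmod (\<Sum>j<n. cis (real j * (x - y))))\<^sup>2"
  have G: "?G absolutely_integrable_on {-pi..pi}"
    using absolutely_integrable_linear[OF set_integrable_norm[OF g] bounded_linear_of_real]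
    by (simp add: o_def)
  have cont: "continuous_on A (\<lambda>y. ?F x y)" for A x
    unfolding cis_conv_exp by (intro continuous_intros)
  have prod: "(\<lambda>y. h y * of_real (?F x y)) absolutely_integrable_on {-pi..pi}"
    if "h absolutely_integrable_on {-pi..pi}" for h :: "real \<Rightarrow> complex" and x
  proof -
    have "(\<lambda>y. of_real (?F x y) * h y) absolutely_integrable_on {-pi..pi}"
    proof (rule absolutely_integrable_bounded_measurable_product[OF bilinear_times _ _ _ that])
      have c: "continuous_on {-pi..pi} (\<lambda>y. complex_of_real (?F x y))"
        by (intro continuous_on_of_real cont)
      then show "(\<lambda>y. complex_of_real (?F x y)) \<in> borel_measurable (lebesgue_on {-pi..pi})"
        by (rule continuous_imp_measurable_on_sets_lebesgue) auto
      show "bounded ((\<lambda>y. complex_of_real (?F x y)) ` {-pi..pi})"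
        by (intro compact_imp_bounded compact_continuous_image c) auto
    qed auto
    then show ?thesis by (simp add: mult.commute)
  qed
  have le: "cmod (\<Sum>m<n. fourier_partial_sum m g x) \<le> Re (\<Sum>m<n. fourier_partial_sum m ?G x)" for x
  proof -
    have "2 * pi * cmod (\<Sum>m<n. fourier_partial_sum m g x)
        = cmod (LINT y:{-pi..pi}|lebesgue. g y * of_real (?F x y))"
      using arg_cong[OF sum_partial_sums_eq_integral[OF g, where n = n and x = x], of cmod] by (simp add: norm_mult)
    also have "\<dots> \<le> (LINT y:{-pi..pi}|lebesgue. cmod (g y * of_real (?F x y)))"
      by (rule set_integral_norm_bound[OF prod[OF g]])
    also have "(\<lambda>y. cmod (g y * of_real (?F x y))) = (\<lambda>y. cmod (g y) * ?F x y)"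
      by (simp only: norm_mult norm_of_real abs_power2)
    also have "(LINT y:{-pi..pi}|lebesgue. cmod (g y) * ?F x y)
        = Re (LINT y:{-pi..pi}|lebesgue. ?G y * of_real (?F x y))"
      unfolding of_real_mult[symmetric] set_integral_complex_of_real Re_complex_of_real ..
    also have "\<dots> = 2 * pi * Re (\<Sum>m<n. fourier_partial_sum m ?G x)"
      using arg_cong[OF sum_partial_sums_eq_integral[OF G, where n = n and x = x], of Re] by simp
    finally show ?thesis by simp
  qed
  have S: "fourier_partial_sum m h absolutely_integrable_on {-pi..pi}" for m h
    unfolding fourier_partial_sum_def trig_poly_eq_trig_sum by auto
  have SS: "(\<lambda>x. \<Sum>m<n. fourier_partial_sum m h x) absolutely_integrable_on {-pi..pi}" for h
    by (intro absolutely_integrable_sum S) auto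
  have "L_norm (\<lambda>x. \<Sum>m<n. fourier_partial_sum m g x)
      \<le> (LINT x:{-pi..pi}|lebesgue. Re (\<Sum>m<n. fourier_partial_sum m ?G x))"
    using SS le absolutely_integrable_linear[OF SS bounded_linear_Re]
    by (intro L_norm_mono) (auto simp: o_def)
  also have "\<dots> = Re (LINT x:{-pi..pi}|lebesgue. (\<Sum>m<n. fourier_partial_sum m ?G x))"
    using integral_Re[OF SS[unfolded set_integrable_def]]
    unfolding set_lebesgue_integral_def by simp
  also have "\<dots> = Re (\<Sum>m<n. 2 * of_real pi * fourier_coeff ?G 0)"
    by (simp add: set_integral_finite_sum S)
       (simp add: fourier_partial_sum_def trig_poly_eq_trig_sum set_integral_trig_sum)
  also have "2 * of_real pi * fourier_coeff ?G 0 = of_real (L_norm g)"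
    unfolding fourier_coeff_eq_cis L_norm_def by (simp add: set_integral_complex_of_real)
  finally show ?thesis by simp
qed



text \<open>
  The average of \<open>S\<^sub>n, \<dots>, S\<^sub>2\<^sub>n\<^sub>-\<^sub>1\<close> is the de la Vallee Poussin mean, a difference of two Fejer sums,
  hence of norm at most \<open>2 + 1\<close> times that of \<open>g\<close>. Replacing each \<open>S\<^sub>m\<close> in the average by \<open>S\<^sub>n\<close>
  costs at most \<open>M\<close>.
\<close>

lemma L_norm_partial_sum_le:
  assumes g: "g absolutely_integrable_on {-pi..pi}" and n: "1 \<le> n"
    and M: "\<And>m. m \<in> {n..<2 * n} \<Longrightarrow>
      L_norm (\<lambda>x. fourier_partial_sum m g x - fourier_partial_sum n g x) \<le> M"
  shows "L_norm (fourier_partial_sum n g) \<le> 3 * L_norm g + M"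
proof -
  let ?S = "\<lambda>m. fourier_partial_sum m g"
  have S: "?S m absolutely_integrable_on {-pi..pi}" for m
    unfolding fourier_partial_sum_def trig_poly_eq_trig_sum by auto
  have SS: "(\<lambda>x. \<Sum>m<k. ?S m x) absolutely_integrable_on {-pi..pi}" for k
    by (intro absolutely_integrable_sum S) auto
  have SD: "(\<lambda>x. \<Sum>m\<in>{n..<2*n}. ?S m x - ?S n x) absolutely_integrable_on {-pi..pi}"
    by (intro absolutely_integrable_sum set_integral_diff S) auto
  have "of_nat n * ?S n x = ((\<Sum>m<2*n. ?S m x) - (\<Sum>m<n. ?S m x)) - (\<Sum>m\<in>{n..<2*n}. ?S m x - ?S n x)"
    for x
  proof -
    have "(\<Sum>m<2*n. ?S m x) = (\<Sum>m<n. ?S m x) + (\<Sum>m\<in>{n..<2*n}. ?S m x)"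
      by (subst sum.union_disjoint[symmetric]) (auto intro: sum.cong)
    then show ?thesis by (simp add: sum_subtractf)
  qed
  then have "real n * L_norm (?S n) =
      L_norm (\<lambda>x. ((\<Sum>m<2*n. ?S m x) - (\<Sum>m<n. ?S m x)) - (\<Sum>m\<in>{n..<2*n}. ?S m x - ?S n x))"
    using L_norm_mult_left[of "of_nat n" "?S n"] by simp
  also have "\<dots> \<le> L_norm (\<lambda>x. (\<Sum>m<2*n. ?S m x) - (\<Sum>m<n. ?S m x))
      + L_norm (\<lambda>x. \<Sum>m\<in>{n..<2*n}. ?S m x - ?S n x)"
    by (intro L_norm_diff set_integral_diff SS SD)
  also have "L_norm (\<lambda>x. (\<Sum>m<2*n. ?S m x) - (\<Sum>m<n. ?S m x))
      \<le> L_norm (\<lambda>x. \<Sum>m<2*n. ?S m x) + L_norm (\<lambda>x. \<Sum>m<n. ?S m x)"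
    by (intro L_norm_diff SS)
  also have "L_norm (\<lambda>x. \<Sum>m\<in>{n..<2*n}. ?S m x - ?S n x)
      \<le> (\<Sum>m\<in>{n..<2*n}. L_norm (\<lambda>x. ?S m x - ?S n x))"
    by (intro L_norm_sum set_integral_diff S) auto
  also have "\<dots> \<le> (\<Sum>m\<in>{n..<2*n}. M)"
    by (intro sum_mono M)
  also have "\<dots> = real n * M" by simp
  also have "L_norm (\<lambda>x. \<Sum>m<2*n. ?S m x) \<le> real (2 * n) * L_norm g"
    by (rule L_norm_sum_partial_sums_le[OF g])
  also have "L_norm (\<lambda>x. \<Sum>m<n. ?S m x) \<le> real n * L_norm g"
    by (rule L_norm_sum_partial_sums_le[OF g])
  finally have "real n * L_norm (?S n) \<le> real n * (3 * L_norm g + M)"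
    by (simp add: algebra_simps)
  then show ?thesis using n by simp
qed

section \<open>Frequencies in a symmetric annulus\<close>

lemma trig_sum_annulus:
  assumes "n \<le> m"
  shows "trig_sum {- int m..int m} a x - trig_sum {- int n..int n} a x =
      trig_sum ({- int m..int m} - {- int n..int n}) a x"
  using assms unfolding trig_sum_def by (subst sum_diff) auto

lemma trig_sum_annulus_split:
  assumes "n \<le> m"
  shows "trig_sum ({- int m..int m} - {- int n..int n}) a x =
      (\<Sum>k\<in>{n<..m}. a (int k) * cis (of_nat k * (1 * x)))
      + (\<Sum>k\<in>{n<..m}. a (- int k) * cis (of_nat k * ((-1) * x)))"
proof -
  have *: "{- int m..int m} - {- int n..int n} = int ` {n<..m} \<union> (\<lambda>k. - int k) ` {n<..m}"
  proof (intro equalityI subsetI)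
    fix k assume "k \<in> {- int m..int m} - {- int n..int n}"
    then have "nat \<bar>k\<bar> \<in> {n<..m}" "k = int (nat \<bar>k\<bar>) \<or> k = - int (nat \<bar>k\<bar>)" by auto
    then show "k \<in> int ` {n<..m} \<union> (\<lambda>k. - int k) ` {n<..m}" by blast
  qed auto
  show ?thesis
    unfolding trig_sum_def *
    by (subst sum.union_disjoint) (auto simp: sum.reindex inj_on_def)
qed

lemma L_norm_annulus_le:
  fixes a :: "int \<Rightarrow> complex"
  assumes "n \<le> m"
  defines "V \<equiv> \<lambda>c::nat \<Rightarrow> complex. cmod (c m) + (\<Sum>k\<in>{n..<m}. cmod (c (k + 1) - c k))"
  shows "L_norm (trig_sum ({- int m..int m} - {- int n..int n}) a)
    \<le> 4 * pi * ln (real (m - n) + 1) * (V (\<lambda>k. a (int k)) + V (\<lambda>k. a (- int k)))"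
proof -
  have int: "(\<lambda>x. \<Sum>k\<in>{n<..m}. c k * cis (real k * (s * x))) absolutely_integrable_on {-pi..pi}"
    for c and s :: real
    unfolding mult.assoc[symmetric] by (intro absolutely_integrable_continuous_real continuous_intros)
  have "L_norm (trig_sum ({- int m..int m} - {- int n..int n}) a) =
      L_norm (\<lambda>x. (\<Sum>k\<in>{n<..m}. a (int k) * cis (of_nat k * (1 * x)))
      + (\<Sum>k\<in>{n<..m}. a (- int k) * cis (of_nat k * ((-1) * x))))"
    by (simp only: trig_sum_annulus_split[OF assms(1), abs_def])
  also have "\<dots> \<le> L_norm (\<lambda>x. \<Sum>k\<in>{n<..m}. a (int k) * cis (of_nat k * (1 * x)))
      + L_norm (\<lambda>x. \<Sum>k\<in>{n<..m}. a (- int k) * cis (of_nat k * ((-1) * x)))"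
    by (intro L_norm_triangle int)
  also have "\<dots> \<le> 4 * pi * ln (real (m - n) + 1) * V (\<lambda>k. a (int k))
      + 4 * pi * ln (real (m - n) + 1) * V (\<lambda>k. a (- int k))"
    unfolding V_def
    by (intro add_mono L_norm_cis_sum_le assms(1)) auto
  finally show ?thesis by (simp add: algebra_simps)
qed

section \<open>Window sums and mean value bounded variation\<close>

definition window :: "real \<Rightarrow> (nat \<Rightarrow> complex) \<Rightarrow> nat \<Rightarrow> real" where
  "window lam c n = (\<Sum>k=nat \<lfloor>inverse lam * real n\<rfloor>..nat \<lfloor>lam * real n\<rfloor>. cmod (c k))"

lemma window_ends:
  fixes lam :: real
  assumes "2 \<le> lam" "L = nat \<lceil>lam\<rceil>"
  shows "n div L \<le> nat \<lfloor>inverse lam * real n\<rfloor>" "nat \<lfloor>inverse lam * real n\<rfloor> \<le> n"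
    "2 * n \<le> nat \<lfloor>lam * real n\<rfloor>" "nat \<lfloor>lam * real n\<rfloor> \<le> L * n"
proof -
  have L: "lam \<le> real L" "2 \<le> L" using assms by linarith+
  have "real (n div L) \<le> real n / real L" by (rule of_nat_div_le_of_nat)
  also have "\<dots> \<le> real n / lam" using L assms(1) by (intro divide_left_mono) auto
  finally show "n div L \<le> nat \<lfloor>inverse lam * real n\<rfloor>"
    by (simp add: le_nat_iff le_floor_iff divide_inverse mult.commute)
  have "inverse lam * real n \<le> 1 * real n"
    using assms(1) by (intro mult_right_mono) (auto simp: field_simps)
  then show "nat \<lfloor>inverse lam * real n\<rfloor> \<le> n" by linarith
  have "2 * real n \<le> lam * real n" using assms(1) by (intro mult_right_mono) auto
  then show "2 * n \<le> nat \<lfloor>lam * real n\<rfloor>" by linarith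
  have "lam * real n \<le> real (L * n)" using L by (simp add: mult_right_mono)
  then show "nat \<lfloor>lam * real n\<rfloor> \<le> L * n" by linarith
qed

text \<open>
  If \<open>2\<^sup>p \<ge> 2 L\<close>, then \<open>p\<close> doublings lead from \<open>n div L\<close> to an index
  that is at least \<open>n\<close>. The exponent \<open>p = 2 L\<close> is
  wasteful but avoids logarithms.
\<close>

lemma doubling_div:
  fixes \<psi> :: "nat \<Rightarrow> real"
  assumes "decseq \<psi>" "0 < C" "\<And>n. C * \<psi> n \<le> \<psi> (2 * n)" "1 \<le> L"
  shows "\<exists>D>0. \<forall>n\<ge>L. \<psi> (n div L) \<le> D * \<psi> n"
proof -
  define p where "p = 2 * L"
  have iter: "C ^ i * \<psi> q \<le> \<psi> (2 ^ i * q)" for i q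
  proof (induction i)
    case (Suc i)
    have "C ^ Suc i * \<psi> q \<le> C * \<psi> (2 ^ i * q)"
      using Suc assms(2) by simp
    also have "\<dots> \<le> \<psi> (2 ^ Suc i * q)"
      using assms(3)[of "2 ^ i * q"] by (simp add: mult_ac)
    finally show ?case .
  qed simp
  have "\<psi> (n div L) \<le> inverse (C ^ p) * \<psi> n" if "L \<le> n" for n
  proof -
    define q where "q = n div L"
    have q: "1 \<le> q" using that assms(4) by (simp add: q_def div_greater_zero_iff Suc_le_eq)
    have "n < L * q + L" unfolding q_def using assms(4) dividend_less_times_div[of L n] by simp
    also have "\<dots> \<le> L * q + L * q" using q by simp
    also have "\<dots> = p * q" by (simp add: p_def)
    also have "\<dots> \<le> 2 ^ p * q" by (intro mult_right_mono) (use less_exp[of p] in linarith, simp)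
    finally have "\<psi> (2 ^ p * q) \<le> \<psi> n" by (intro decseqD[OF assms(1)]) simp
    then have "C ^ p * \<psi> q \<le> \<psi> n" using iter[of p q] by simp
    then show ?thesis using assms(2) by (simp add: q_def field_simps)
  qed
  then show ?thesis using assms(2) by (intro exI[of _ "inverse (C ^ p)"]) auto
qed

text \<open>
  The threshold \<open>4 L\<^sup>2\<close> comes from \<open>n \<le> 2 L (n div L)\<close>: squaring gives \<open>n \<le> (n div L)\<^sup>2\<close> as soon as
  \<open>4 L\<^sup>2 \<le> n\<close>.
\<close>

lemma ln_div_ge:
  fixes L n :: nat
  assumes "1 \<le> L" "4 * L\<^sup>2 \<le> n"
  shows "1 \<le> n div L" "ln (real n) \<le> 2 * ln (real (n div L))"
proof -
  define q where "q = n div L"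
  have "1 * L \<le> 4 * L * L" using assms(1) by (intro mult_le_mono) auto
  then have "L \<le> n" using assms(2) unfolding power2_eq_square by linarith
  then show q: "1 \<le> n div L" using assms(1) by (simp add: div_greater_zero_iff Suc_le_eq)
  have "n < L * q + L" unfolding q_def using assms(1) dividend_less_times_div[of L n] by simp
  also have "\<dots> \<le> L * q + L * q" using q by (simp add: q_def)
  finally have "n \<le> 2 * L * q" by simp
  then have "n * n \<le> (2 * L * q) * (2 * L * q)" by (intro mult_le_mono)
  also have "\<dots> = 4 * L\<^sup>2 * q\<^sup>2" by (simp add: power2_eq_square)
  also have "\<dots> \<le> n * q\<^sup>2" using assms(2) by (intro mult_le_mono) auto
  finally have "n * n \<le> n * q\<^sup>2" .
  then have "n \<le> q\<^sup>2" using \<open>L \<le> n\<close> assms(1) by simp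
  then have "real n \<le> real q ^ 2" by (metis of_nat_le_iff of_nat_power)
  then have "ln (real n) \<le> ln (real q ^ 2)"
    using \<open>L \<le> n\<close> assms(1) by (intro ln_mono) auto
  then show "ln (real n) \<le> 2 * ln (real (n div L))" using q by (simp add: ln_realpow q_def)
qed

text \<open>
  All indices in the window are comparable with \<open>n\<close>, so neither \<open>\<psi>\<close> nor the logarithm changes by
  more than a constant factor there.
\<close>

lemma window_bound_of_coeff_bound:
  fixes \<psi> :: "nat \<Rightarrow> real" and c :: "nat \<Rightarrow> complex"
  assumes \<psi>: "decseq \<psi>" "\<And>n. 0 \<le> \<psi> n" and R: "\<And>L. 1 \<le> L \<Longrightarrow> \<exists>D>0. \<forall>n\<ge>L. \<psi> (n div L) \<le> D * \<psi> n"
    and lam: "2 \<le> lam" and B: "\<forall>n\<ge>N. cmod (c n) * ln (real n) \<le> B * \<psi> n"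
  shows "\<exists>B'\<ge>0. \<exists>N'. \<forall>n\<ge>N'. window lam c n * ln (real n) \<le> B' * (real n * \<psi> n)"
proof -
  define L where "L = nat \<lceil>lam\<rceil>"
  have L: "1 \<le> L" using lam unfolding L_def by linarith
  note ends = window_ends[OF lam L_def]
  obtain D where D: "D > 0" "\<And>n. n \<ge> L \<Longrightarrow> \<psi> (n div L) \<le> D * \<psi> n"
    using R[OF L] by blast
  let ?B = "2 * \<bar>B\<bar> * D"
  have "window lam c n * ln (real n) \<le> (real (L + 1) * ?B) * (real n * \<psi> n)"
    if n: "n \<ge> L * (N + 1) + 4 * L\<^sup>2" for n
  proof -
    define q where "q = n div L"
    have q: "1 \<le> q" "ln (real n) \<le> 2 * ln (real q)"
      using ln_div_ge[OF L, of n] n by (auto simp: q_def)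
    have "L * (N + 1) \<le> n" using n by linarith
    then have "N + 1 \<le> q" using L by (simp add: q_def less_eq_div_iff_mult_less_eq mult.commute)
    have "L \<le> L * (N + 1)" by simp
    then have nL: "L \<le> n" "1 \<le> n" using n L by linarith+
    have "cmod (c k) * ln (real n) \<le> ?B * \<psi> n" if "q \<le> k" for k
    proof -
      have "ln (real n) \<le> 2 * ln (real k)"
        using q that by (smt (verit) ln_le_cancel_iff of_nat_0_less_iff of_nat_le_iff less_eq_Suc_le One_nat_def)
      then have "cmod (c k) * ln (real n) \<le> 2 * (cmod (c k) * ln (real k))"
        using mult_left_mono[of "ln (real n)" "2 * ln (real k)" "cmod (c k)"] by simp
      also have "\<dots> \<le> 2 * (\<bar>B\<bar> * \<psi> k)"
      proof -
        have "cmod (c k) * ln (real k) \<le> B * \<psi> k" using B that \<open>N + 1 \<le> q\<close> by simp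
        also have "\<dots> \<le> \<bar>B\<bar> * \<psi> k" using \<psi>(2) by (intro mult_right_mono) auto
        finally show ?thesis by simp
      qed
      also have "\<dots> \<le> 2 * (\<bar>B\<bar> * \<psi> q)"
        using decseqD[OF \<psi>(1) that] by (simp add: mult_left_mono)
      also have "\<dots> \<le> 2 * (\<bar>B\<bar> * (D * \<psi> n))"
        using D(2)[OF nL(1)] by (simp add: q_def mult_left_mono)
      finally show ?thesis by (simp add: mult_ac)
    qed
    then have "window lam c n * ln (real n) \<le>
        (\<Sum>k=nat \<lfloor>inverse lam * real n\<rfloor>..nat \<lfloor>lam * real n\<rfloor>. ?B * \<psi> n)"
      unfolding window_def sum_distrib_right
      using ends(1)[of n] by (intro sum_mono) (auto simp: q_def)
    also have "\<dots> = real (Suc (nat \<lfloor>lam * real n\<rfloor>) - nat \<lfloor>inverse lam * real n\<rfloor>) * (?B * \<psi> n)"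
      by simp
    also have "\<dots> \<le> (real (L + 1) * real n) * (?B * \<psi> n)"
    proof (intro mult_right_mono)
      have "Suc (nat \<lfloor>lam * real n\<rfloor>) - nat \<lfloor>inverse lam * real n\<rfloor> \<le> Suc (L * n)"
        using ends(4)[of n] by linarith
      also have "\<dots> \<le> (L + 1) * n" using nL by simp
      finally show "real (Suc (nat \<lfloor>lam * real n\<rfloor>) - nat \<lfloor>inverse lam * real n\<rfloor>) \<le> real (L + 1) * real n"
        by (metis of_nat_le_iff of_nat_mult)
      show "0 \<le> ?B * \<psi> n" using D(1) \<psi>(2)[of n] by simp
    qed
    finally show ?thesis by (simp add: mult_ac)
  qed
  then show ?thesis using D(1) by (intro exI[of _ "real (L + 1) * ?B"] conjI exI[of _ "L * (N + 1) + 4 * L\<^sup>2"]) auto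
qed

text \<open>
  One sum \<open>\<Sum>k=1..i. \<bar>c (i + k)\<bar> / k\<close> sees the logarithm only through many different coefficients.
  Summing over all \<open>i\<close> from \<open>m\<close> to \<open>T\<close> lets every fixed \<open>c j\<close> with \<open>j \<in> {2m..T}\<close> appear with each of the
  weights \<open>1, 1/2, \<dots>, 1/m\<close>, so that it collects a full harmonic sum.
\<close>

lemma window_bound_of_hilbert_sums:
  fixes \<psi> :: "nat \<Rightarrow> real" and c :: "nat \<Rightarrow> complex"
  assumes \<psi>: "decseq \<psi>" "\<And>n. 0 \<le> \<psi> n" and R: "\<And>L. 1 \<le> L \<Longrightarrow> \<exists>D>0. \<forall>n\<ge>L. \<psi> (n div L) \<le> D * \<psi> n"
    and lam: "2 \<le> lam" and A: "0 \<le> A" "\<forall>n\<ge>N. (\<Sum>k=1..n. cmod (c (n + k)) / real k) \<le> A * \<psi> n"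
  shows "\<exists>B'\<ge>0. \<exists>N'. \<forall>n\<ge>N'. window lam c n * ln (real n) \<le> B' * (real n * \<psi> n)"
proof -
  define L where "L = nat \<lceil>lam\<rceil>"
  have L: "1 \<le> L" using lam unfolding L_def by linarith
  note ends = window_ends[OF lam L_def]
  have L2: "1 \<le> 2 * L" using L by simp
  obtain D where D: "D > 0" "\<And>n. n \<ge> 2 * L \<Longrightarrow> \<psi> (n div (2 * L)) \<le> D * \<psi> n"
    using R[OF L2] by blast
  have "window lam c n * ln (real n) \<le> (2 * (real (L + 1) * (A * D))) * (real n * \<psi> n)"
    if n: "n \<ge> 2 * L * (N + 1) + 4 * (2 * L)\<^sup>2" for n
  proof -
    define m where "m = n div (2 * L)"
    \<comment> \<open>The window lies between \<open>2 m\<close> and \<open>T\<close>.\<close>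
    define T where "T = L * n"
    have m: "1 \<le> m" "ln (real n) \<le> 2 * ln (real m)"
      using ln_div_ge[OF L2, of n] n by (auto simp: m_def)
    have "2 * L * (N + 1) \<le> n" using n by linarith
    then have mN: "N + 1 \<le> m" using L2 by (simp add: m_def less_eq_div_iff_mult_less_eq mult.commute)
    have "2 * L \<le> 2 * L * (N + 1)" by simp
    then have nL: "2 * L \<le> n" "1 \<le> n" using n L by linarith+
    have "m * (2 * L) \<le> n" by (simp add: m_def)
    then have "2 * m * L \<le> n" by (simp add: mult_ac)
    then have "2 * m \<le> n div L" using L by (simp add: less_eq_div_iff_mult_less_eq)
    then have sub: "{nat \<lfloor>inverse lam * real n\<rfloor>..nat \<lfloor>lam * real n\<rfloor>} \<subseteq> {2 * m..T}"
      using ends(1,4)[of n] by (auto simp: T_def)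
    let ?W = "\<Sum>j=2*m..T. cmod (c j)"
    have harm: "ln (real m) \<le> (\<Sum>k=1..m. 1 / real k)"
    proof -
      have "ln (real m) \<le> ln (real m + 1)" using m by simp
      also have "\<dots> \<le> harm m" by (rule ln_le_harm)
      finally show ?thesis by (simp add: harm_def divide_inverse)
    qed
    have "?W * ln (real m) \<le> ?W * (\<Sum>k=1..m. 1 / real k)"
      by (intro mult_left_mono harm sum_nonneg) auto
    also have "\<dots> = (\<Sum>j=2*m..T. \<Sum>k=1..m. cmod (c j) / real k)"
      unfolding sum_product by simp
    also have "\<dots> = (\<Sum>k=1..m. \<Sum>j=2*m..T. cmod (c j) / real k)"
      by (rule sum.swap)
    also have "\<dots> \<le> (\<Sum>k=1..m. \<Sum>i=m..T. cmod (c (i + k)) / real k)"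
    proof (intro sum_mono)
      fix k assume k: "k \<in> {1..m}"
      have "(\<Sum>j=2*m..T. cmod (c j) / real k) \<le> (\<Sum>j\<in>(\<lambda>i. i + k) ` {m..T}. cmod (c j) / real k)"
      proof (intro sum_mono2 subsetI)
        fix j assume "j \<in> {2*m..T}"
        then have "j = (j - k) + k" "j - k \<in> {m..T}" using k by auto
        then show "j \<in> (\<lambda>i. i + k) ` {m..T}" by blast
      qed auto
      also have "\<dots> = (\<Sum>i=m..T. cmod (c (i + k)) / real k)"
        by (subst sum.reindex) auto
      finally show "(\<Sum>j=2*m..T. cmod (c j) / real k) \<le> (\<Sum>i=m..T. cmod (c (i + k)) / real k)" .
    qed
    also have "\<dots> = (\<Sum>i=m..T. \<Sum>k=1..m. cmod (c (i + k)) / real k)"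
      by (rule sum.swap)
    also have "\<dots> \<le> (\<Sum>i=m..T. A * \<psi> m)"
    proof (intro sum_mono)
      fix i assume i: "i \<in> {m..T}"
      have "(\<Sum>k=1..m. cmod (c (i + k)) / real k) \<le> (\<Sum>k=1..i. cmod (c (i + k)) / real k)"
        using i by (intro sum_mono2) auto
      also have "\<dots> \<le> A * \<psi> i" using A(2) i mN by auto
      also have "\<dots> \<le> A * \<psi> m" using A(1) i decseqD[OF \<psi>(1), of m i] by (auto intro: mult_left_mono)
      finally show "(\<Sum>k=1..m. cmod (c (i + k)) / real k) \<le> A * \<psi> m" .
    qed
    also have "\<dots> = real (Suc T - m) * (A * \<psi> m)" by simp
    also have "\<dots> \<le> (real (L + 1) * real n) * (A * \<psi> m)"
    proof (intro mult_right_mono)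
      have "Suc T - m \<le> (L + 1) * n" using nL by (simp add: T_def)
      then show "real (Suc T - m) \<le> real (L + 1) * real n" by (metis of_nat_le_iff of_nat_mult)
    qed (use A \<psi> in auto)
    also have "\<dots> \<le> (real (L + 1) * real n) * (A * (D * \<psi> n))"
      using D(2)[OF nL(1)] A(1) by (intro mult_left_mono) (auto simp: m_def)
    finally have W: "?W * ln (real m) \<le> (real (L + 1) * real n) * (A * (D * \<psi> n))" .
    have "window lam c n \<le> ?W"
      unfolding window_def using sub by (intro sum_mono2) auto
    then have "window lam c n * ln (real n) \<le> ?W * (2 * ln (real m))"
      using m nL by (intro mult_mono sum_nonneg) auto
    also have "\<dots> = 2 * (?W * ln (real m))" by simp
    also have "\<dots> \<le> 2 * ((real (L + 1) * real n) * (A * (D * \<psi> n)))" using W by simp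
    finally show ?thesis by (simp add: mult_ac)
  qed
  then show ?thesis using D(1) A(1)
    by (intro exI[of _ "2 * (real (L + 1) * (A * D))"] conjI exI[of _ "2 * L * (N + 1) + 4 * (2 * L)\<^sup>2"]) auto
qed

text \<open>
  The mean value condition bounds the variation over \<open>{n..2n}\<close> by the average over the window, and
  \<open>\<bar>c m\<bar>\<close> exceeds the average of the coefficients over \<open>{n<..2n}\<close> by at most that variation.
\<close>

lemma coeff_bound_of_window_bound:
  fixes \<psi> :: "nat \<Rightarrow> real" and c :: "nat \<Rightarrow> complex"
  assumes lam: "2 \<le> lam" and C: "0 < C"
    and mv: "\<And>n. 1 \<le> n \<Longrightarrow> (\<Sum>k=n..2*n. cmod (c (k + 1) - c k)) \<le> C / real n * window lam c n"
    and W: "\<forall>n\<ge>N. window lam c n * ln (real n) \<le> B * (real n * \<psi> n)"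
  shows "\<exists>N'. \<forall>n\<ge>N'. \<forall>m\<in>{n..2*n}.
    (cmod (c m) + (\<Sum>k\<in>{n..<m}. cmod (c (k + 1) - c k))) * ln (real n) \<le> ((1 + 3 * C) * B) * \<psi> n"
proof -
  have "(cmod (c m) + (\<Sum>k\<in>{n..<m}. cmod (c (k + 1) - c k))) * ln (real n) \<le> ((1 + 3 * C) * B) * \<psi> n"
    if n: "n \<ge> N + 1" and m: "m \<in> {n..2*n}" for n m
  proof -
    note ends = window_ends[OF lam refl, of n]
    define V where "V = (\<Sum>k=n..2*n. cmod (c (k + 1) - c k))"
    have V: "V \<le> C / real n * window lam c n" unfolding V_def using mv n by simp
    have diff: "cmod (c i) \<le> cmod (c j) + V" if "i \<in> {n..2*n}" "j \<in> {n..2*n}" for i j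
    proof -
      have tel: "cmod (c j - c i) \<le> V" if "n \<le> i" "i \<le> j" "j \<le> 2*n" for i j
      proof -
        have "c j - c i = (\<Sum>k\<in>{i..<j}. c (k + 1) - c k)"
          using sum_Suc_diff'[OF \<open>i \<le> j\<close>, of c] by simp
        then have "cmod (c j - c i) \<le> (\<Sum>k\<in>{i..<j}. cmod (c (k + 1) - c k))"
          by (simp add: norm_sum)
        also have "\<dots> \<le> V" unfolding V_def using that by (intro sum_mono2) auto
        finally show ?thesis .
      qed
      have "cmod (c i - c j) \<le> V"
        using tel[of i j] tel[of j i] that by (cases "i \<le> j") (auto simp: norm_minus_commute)
      then show ?thesis using norm_triangle_ineq2[of "c i" "c j"] by linarith
    qed
    have "real n * cmod (c m) = (\<Sum>j\<in>{n<..2*n}. cmod (c m))" by simp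
    also have "\<dots> \<le> (\<Sum>j\<in>{n<..2*n}. cmod (c j) + V)"
      using m by (intro sum_mono diff) auto
    also have "\<dots> = (\<Sum>j\<in>{n<..2*n}. cmod (c j)) + real n * V" by (simp add: sum.distrib)
    also have "(\<Sum>j\<in>{n<..2*n}. cmod (c j)) \<le> window lam c n"
      unfolding window_def using ends by (intro sum_mono2) auto
    finally have 1: "real n * cmod (c m) \<le> window lam c n + real n * V" by simp
    have 2: "(\<Sum>k\<in>{n..<m}. cmod (c (k + 1) - c k)) \<le> V"
      unfolding V_def using m by (intro sum_mono2) auto
    have 3: "real n * V \<le> C * window lam c n" using V n by (simp add: field_simps)
    have w0: "0 \<le> window lam c n" unfolding window_def by (intro sum_nonneg) auto
    have "real n * (cmod (c m) + (\<Sum>k\<in>{n..<m}. cmod (c (k + 1) - c k)))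
      \<le> window lam c n + 2 * (real n * V)"
      using 1 mult_left_mono[OF 2, of "real n"] by (simp add: distrib_left)
    also have "\<dots> \<le> (1 + 3 * C) * window lam c n"
    proof -
      have "0 \<le> C * window lam c n" using C w0 by simp
      moreover have "(1 + 3 * C) * window lam c n = window lam c n + 3 * (C * window lam c n)"
        by (simp add: algebra_simps)
      ultimately show ?thesis using 3 by linarith
    qed
    finally have "real n * (cmod (c m) + (\<Sum>k\<in>{n..<m}. cmod (c (k + 1) - c k))) * ln (real n)
      \<le> (1 + 3 * C) * window lam c n * ln (real n)"
      using n by (intro mult_right_mono) auto
    also have "\<dots> \<le> (1 + 3 * C) * (B * (real n * \<psi> n))"
      unfolding mult.assoc using W n C by (intro mult_left_mono) auto
    finally have "real n * ((cmod (c m) + (\<Sum>k\<in>{n..<m}. cmod (c (k + 1) - c k))) * ln (real n))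
      \<le> real n * (((1 + 3 * C) * B) * \<psi> n)" by (simp add: mult_ac)
    then show ?thesis using n by simp
  qed
  then show ?thesis by blast
qed

text \<open>
  The window parameter \<open>lam\<close> is only known to exist, which is why the hypothesis on window sums asks
  for all \<open>lam \<ge> 2\<close>.
\<close>

lemma MVBVS_coeff_bound:
  fixes \<psi> :: "nat \<Rightarrow> real"
  assumes c: "c \<in> MVBVS"
    and W: "\<And>lam. 2 \<le> lam \<Longrightarrow> \<exists>B N. \<forall>n\<ge>N. window lam c n * ln (real n) \<le> B * (real n * \<psi> n)"
  shows "\<exists>B N. \<forall>n\<ge>N. \<forall>m\<in>{n..2*n}.
    (cmod (c m) + (\<Sum>k\<in>{n..<m}. cmod (c (k + 1) - c k))) * ln (real n) \<le> B * \<psi> n"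
proof -
  obtain lam C where lam: "2 \<le> lam" and C: "0 < C"
    and mv: "\<And>n. 1 \<le> n \<Longrightarrow> (\<Sum>k=n..2*n. cmod (c (k + 1) - c k)) \<le> C / real n * window lam c n"
    using c unfolding MVBVS_def window_def by blast
  obtain B N where "\<forall>n\<ge>N. window lam c n * ln (real n) \<le> B * (real n * \<psi> n)"
    using W[OF lam] by blast
  from coeff_bound_of_window_bound[OF lam C mv this] show ?thesis by blast
qed

lemma coeff_variation_bound_of_coeff_bound:
  fixes \<psi> :: "nat \<Rightarrow> real"
  assumes \<psi>: "decseq \<psi>" "\<And>n. 0 \<le> \<psi> n" and R: "\<And>L. 1 \<le> L \<Longrightarrow> \<exists>D>0. \<forall>n\<ge>L. \<psi> (n div L) \<le> D * \<psi> n"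
    and mv: "c \<in> MVBVS" and B: "\<forall>n\<ge>N. cmod (c n) * ln (real n) \<le> B * \<psi> n"
  shows "\<exists>B N. \<forall>n\<ge>N. \<forall>m\<in>{n..2*n}.
    (cmod (c m) + (\<Sum>k\<in>{n..<m}. cmod (c (k + 1) - c k))) * ln (real n) \<le> B * \<psi> n"
  using window_bound_of_coeff_bound[OF \<psi> R _ B] by (intro MVBVS_coeff_bound[OF mv]) blast



section \<open>Hardy-type sums of coefficients in a sector\<close>

lemma sector_Re_ge:
  assumes "z \<in> sector \<theta>" "\<theta> \<le> pi"
  shows "cos \<theta> * cmod z \<le> Re z"
proof (cases "z = 0")
  case False
  have "cos \<theta> \<le> cos \<bar>Arg z\<bar>"
    using assms False by (intro cos_monotone_0_pi_le) (auto simp: sector_def)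
  moreover have "Re z = cmod z * cos (Arg z)"
    using arg_cong[OF rcis_cmod_Arg[of z], of Re] by simp
  ultimately show ?thesis by (simp add: mult.commute mult_left_mono)
qed simp

text \<open>
  Apply the Hardy-type inequality around \<open>p = \<plusminus>n\<close> to the frequencies \<open>n < \<bar>k\<bar> \<le> 2n\<close>. The
  frequencies on the side of \<open>p\<close> give the sum with weights \<open>1 / k\<close>. Those on the other side are at
  distance more than \<open>2n\<close> from \<open>p\<close>, so for them it suffices that no coefficient exceeds the norm. The
  sector condition then turns the modulus of the sum into the sum of the moduli.
\<close>

lemma hilbert_sum_sector_le:
  assumes s: "s = 1 \<or> s = (-1::int)" and n: "1 \<le> n"
    and \<theta>: "\<theta> \<le> pi" "\<And>k. a (s * int k) \<in> sector \<theta>"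
  shows "cos \<theta> * (\<Sum>k=1..n. cmod (a (s * int (n + k))) / real k)
    \<le> L_norm (trig_sum ({- int (2 * n)..int (2 * n)} - {- int n..int n}) a)"
proof -
  define K where "K = {- int (2 * n)..int (2 * n)} - {- int n..int n}"
  define t where "t = L_norm (trig_sum K a)"
  define P where "P = (\<Sum>k=1..n. a (s * int (n + k)) / of_nat k)"
  define Q where "Q = (\<Sum>j\<in>{n<..2*n}. a (- s * int j) / of_int (- s * int j - s * int n))"
  have t0: "0 \<le> t" unfolding t_def by (rule L_norm_nonneg)
  have K_eq: "K = (\<lambda>j. s * int j) ` {n<..2*n} \<union> (\<lambda>j. - s * int j) ` {n<..2*n}"
  proof (intro equalityI subsetI)
    fix k assume "k \<in> K"
    then have "nat \<bar>k\<bar> \<in> {n<..2*n}" "k = s * int (nat \<bar>k\<bar>) \<or> k = - s * int (nat \<bar>k\<bar>)"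
      using s by (auto simp: K_def)
    then show "k \<in> (\<lambda>j. s * int j) ` {n<..2*n} \<union> (\<lambda>j. - s * int j) ` {n<..2*n}" by blast
  qed (use s in \<open>auto simp: K_def\<close>)
  have fin: "finite K" by (simp add: K_def)
  have coeff: "cmod (a k) \<le> t / (2 * pi)" if "k \<in> K" for k
    using norm_fourier_coeff_le[OF absolutely_integrable_trig_sum, of K a k]
      fourier_coeff_trig_sum[OF fin, of a k] that by (simp add: t_def)
  have "(\<Sum>k\<in>K. a k / of_int (k - s * int n)) =
      (\<Sum>j\<in>{n<..2*n}. a (s * int j) / of_int (s * int j - s * int n)) + Q"
    unfolding K_eq Q_def using s
    by (subst sum.union_disjoint) (auto simp: sum.reindex inj_on_def)
  also have "(\<Sum>j\<in>{n<..2*n}. a (s * int j) / of_int (s * int j - s * int n)) =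
      (\<Sum>k=1..n. a (s * int (n + k)) / of_int (s * int k))"
    by (rule sum.reindex_bij_witness[of _ "\<lambda>k. n + k" "\<lambda>j. j - n"]) (auto simp: algebra_simps)
  also have "\<dots> = of_int s * P"
    unfolding P_def sum_distrib_left using s by (intro sum.cong refl) auto
  finally have "cmod (of_int s * P + Q) \<le> t / 2"
    using norm_hilbert_sum_le[OF fin, of "s * int n" a] s by (auto simp: t_def K_def)
  moreover have "cmod (of_int s * P) = cmod P" using s by (auto simp: norm_mult)
  moreover have "cmod Q \<le> t / 2"
  proof -
    have "cmod Q \<le> (\<Sum>j\<in>{n<..2*n}. t / (2 * real n))"
      unfolding Q_def
    proof (rule sum_norm_le)
      fix j assume j: "j \<in> {n<..2*n}"
      have "cmod (of_int (- s * int j - s * int n)) = real j + real n"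
        using s by (auto simp: norm_of_int simp flip: of_int_diff of_int_minus of_int_add)
      moreover have "cmod (a (- s * int j)) \<le> t / (2 * pi)"
        using j by (intro coeff) (auto simp: K_eq)
      moreover have "t / (2 * pi) \<le> t / 2"
        using t0 pi_gt3 by (intro divide_left_mono) auto
      ultimately show "cmod (a (- s * int j) / of_int (- s * int j - s * int n)) \<le> t / (2 * real n)"
        unfolding norm_divide using n t0 frac_le[of "t / 2" "cmod (a (- s * int j))" "real n" "real j + real n"]
        by auto
    qed
    also have "\<dots> = t / 2" using n by simp
    finally show ?thesis .
  qed
  ultimately have "cmod P \<le> t"
    using norm_triangle_ineq4[of "of_int s * P + Q" Q] by simp
  have "cos \<theta> * (\<Sum>k=1..n. cmod (a (s * int (n + k))) / real k)
      = (\<Sum>k=1..n. cos \<theta> * cmod (a (s * int (n + k))) / real k)"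
    by (simp add: sum_distrib_left)
  also have "\<dots> \<le> (\<Sum>k=1..n. Re (a (s * int (n + k))) / real k)"
    by (intro sum_mono divide_right_mono sector_Re_ge \<theta>) auto
  also have "\<dots> = Re P" by (simp add: P_def Re_divide_of_nat)
  also have "\<dots> \<le> cmod P" by (rule complex_Re_le_cmod)
  finally show ?thesis using \<open>cmod P \<le> t\<close> by (simp add: t_def K_def)
qed

section \<open>Approximation by partial sums\<close>

text \<open>
  For a polynomial \<open>T\<close> of degree \<open>n\<close> and \<open>g = f - T\<close> one has \<open>f - S\<^sub>n f = g - S\<^sub>n g\<close>, because \<open>S\<^sub>n\<close>
  reproduces \<open>T\<close>. Moreover \<open>f\<close> and \<open>g\<close> have the same coefficients beyond \<open>n\<close>, so
  \<open>S\<^sub>m g - S\<^sub>n g = S\<^sub>m f - S\<^sub>n f\<close> and the bound \<open>M\<close> does not depend on \<open>T\<close>; this allows passing to the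
  infimum over \<open>T\<close>.
\<close>

lemma L_norm_remainder_le_best_approx:
  assumes f: "f absolutely_integrable_on {-pi..pi}" and n: "1 \<le> n"
    and M: "\<And>m. m \<in> {n..<2 * n} \<Longrightarrow>
      L_norm (\<lambda>x. fourier_partial_sum m f x - fourier_partial_sum n f x) \<le> M"
  shows "L_norm (\<lambda>x. f x - fourier_partial_sum n f x) \<le> 4 * best_approx n f + M"
proof -
  \<comment> \<open>The bound is solved for the norm of \<open>f - T\<close>, so that the infimum over the coefficients of \<open>T\<close> applies.\<close>
  have "(L_norm (\<lambda>x. f x - fourier_partial_sum n f x) - M) / 4 \<le> L_norm (\<lambda>x. f x - trig_poly n c x)" for c
  proof -
    define T where "T = trig_poly n c"
    define g where "g = (\<lambda>x. f x - T x)"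
    have T: "T = trig_sum {- int n..int n} c" by (simp add: T_def trig_poly_eq_trig_sum)
    have g: "g absolutely_integrable_on {-pi..pi}"
      unfolding g_def T by (intro set_integral_diff f) auto
    have coeff: "fourier_coeff g k = fourier_coeff f k - (if k \<in> {- int n..int n} then c k else 0)" for k
      unfolding g_def T by (subst fourier_coeff_diff[OF f]) (auto simp: fourier_coeff_trig_sum)
    have S: "fourier_partial_sum m g x = fourier_partial_sum m f x - T x" if "n \<le> m" for m x
    proof -
      have "fourier_partial_sum m g x = fourier_partial_sum m f x -
          (\<Sum>k\<in>{- int m..int m}. (if k \<in> {- int n..int n} then c k else 0) * cis (of_int k * x))"
        unfolding fourier_partial_sum_def trig_poly_eq_trig_sum trig_sum_def coeff
        by (simp only: left_diff_distrib sum_subtractf)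
      also have "(\<Sum>k\<in>{- int m..int m}. (if k \<in> {- int n..int n} then c k else 0) * cis (of_int k * x)) = T x"
        unfolding T trig_sum_def using that by (intro sum.mono_neutral_cong_right) auto
      finally show ?thesis .
    qed
    have "f x - fourier_partial_sum n f x = g x - fourier_partial_sum n g x" for x
      unfolding S[OF order_refl] by (simp add: g_def)
    then have "L_norm (\<lambda>x. f x - fourier_partial_sum n f x) = L_norm (\<lambda>x. g x - fourier_partial_sum n g x)"
      by simp
    also have "\<dots> \<le> L_norm g + L_norm (fourier_partial_sum n g)"
      by (intro L_norm_diff g) (auto simp: fourier_partial_sum_def trig_poly_eq_trig_sum)
    also have "L_norm (fourier_partial_sum n g) \<le> 3 * L_norm g + M"
      using M by (intro L_norm_partial_sum_le g n) (auto simp: S)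
    finally show ?thesis by (simp add: g_def T_def)
  qed
  then have "(L_norm (\<lambda>x. f x - fourier_partial_sum n f x) - M) / 4 \<le> best_approx n f"
    unfolding best_approx_def by (intro cINF_greatest) auto
  then show ?thesis by simp
qed

lemma best_approx_le: "best_approx n f \<le> L_norm (\<lambda>x. f x - trig_poly n c x)"
  unfolding best_approx_def by (intro cINF_lower bdd_belowI2[of _ 0] L_norm_nonneg) auto

lemma best_approx_nonneg: "0 \<le> best_approx n f"
  unfolding best_approx_def by (intro cINF_greatest L_norm_nonneg) auto

text \<open>
  The difference of the remainders at \<open>n\<close> and \<open>2n\<close> is the trigonometric sum over
  \<open>n < \<bar>k\<bar> \<le> 2n\<close>, so the Hardy-type inequality applies to it at every scale \<open>n\<close>.
\<close>

lemma coeff_bound_of_L_norm_bound: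
  fixes \<psi> :: "nat \<Rightarrow> real"
  assumes f: "f absolutely_integrable_on {-pi..pi}"
    and \<psi>: "decseq \<psi>" "\<And>n. 0 \<le> \<psi> n" and R: "\<And>L. 1 \<le> L \<Longrightarrow> \<exists>D>0. \<forall>n\<ge>L. \<psi> (n div L) \<le> D * \<psi> n"
    and s: "s = 1 \<or> s = (-1::int)" and mv: "(\<lambda>n. fourier_coeff f (s * int n)) \<in> MVBVS"
    and B: "\<forall>n\<ge>N. L_norm (\<lambda>x. f x - fourier_partial_sum n f x) \<le> B * \<psi> n"
  shows "\<exists>B N. \<forall>n\<ge>N. cmod (fourier_coeff f (s * int n)) * ln (real n) \<le> B * \<psi> n"
proof -
  let ?a = "fourier_coeff f" and ?S = "\<lambda>n. fourier_partial_sum n f"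
  obtain \<theta> where \<theta>: "0 \<le> \<theta>" "\<theta> < pi / 2" "\<And>n. ?a (s * int n) \<in> sector \<theta>"
    using mv unfolding MVBVS_def by blast
  have cos: "0 < cos \<theta>" using \<theta> by (intro cos_gt_zero_pi) auto
  have int: "?S n absolutely_integrable_on {-pi..pi}" for n
    unfolding fourier_partial_sum_def trig_poly_eq_trig_sum by auto
  have "(\<Sum>k=1..n. cmod (?a (s * int (n + k))) / real k) \<le> (2 * \<bar>B\<bar> / cos \<theta>) * \<psi> n"
    if n: "n \<ge> N + 1" for n
  proof -
    have "cos \<theta> * (\<Sum>k=1..n. cmod (?a (s * int (n + k))) / real k)
        \<le> L_norm (trig_sum ({- int (2 * n)..int (2 * n)} - {- int n..int n}) ?a)"
      using n \<theta> by (intro hilbert_sum_sector_le s) auto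
    also have "trig_sum ({- int (2 * n)..int (2 * n)} - {- int n..int n}) ?a
        = (\<lambda>x. (f x - ?S n x) - (f x - ?S (2 * n) x))"
      unfolding fourier_partial_sum_def trig_poly_eq_trig_sum
      by (rule ext, subst trig_sum_annulus[symmetric]) auto
    also have "L_norm \<dots> \<le> L_norm (\<lambda>x. f x - ?S n x) + L_norm (\<lambda>x. f x - ?S (2 * n) x)"
      by (intro L_norm_diff set_integral_diff f int)
    also have "\<dots> \<le> \<bar>B\<bar> * \<psi> n + \<bar>B\<bar> * \<psi> n"
    proof (intro add_mono)
      have *: "L_norm (\<lambda>x. f x - ?S m x) \<le> \<bar>B\<bar> * \<psi> m" if "m \<ge> N" for m
        using B that mult_right_mono[OF abs_ge_self[of B] \<psi>(2)[of m]] by fastforce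
      then show "L_norm (\<lambda>x. f x - ?S n x) \<le> \<bar>B\<bar> * \<psi> n" using n by simp
      have "L_norm (\<lambda>x. f x - ?S (2 * n) x) \<le> \<bar>B\<bar> * \<psi> (2 * n)" using n by (intro *) simp
      also have "\<dots> \<le> \<bar>B\<bar> * \<psi> n" using decseqD[OF \<psi>(1), of n "2 * n"] by (simp add: mult_left_mono)
      finally show "L_norm (\<lambda>x. f x - ?S (2 * n) x) \<le> \<bar>B\<bar> * \<psi> n" .
    qed
    finally show ?thesis using cos by (simp add: field_simps)
  qed
  then have H: "\<forall>n\<ge>N + 1. (\<Sum>k=1..n. cmod (?a (s * int (n + k))) / real k) \<le> (2 * \<bar>B\<bar> / cos \<theta>) * \<psi> n"
    by blast
  have "\<exists>B N. \<forall>n\<ge>N. \<forall>m\<in>{n..2*n}. (cmod (?a (s * int m))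
      + (\<Sum>k\<in>{n..<m}. cmod (?a (s * int (k + 1)) - ?a (s * int k)))) * ln (real n) \<le> B * \<psi> n"
    using window_bound_of_hilbert_sums[OF \<psi> R _ _ H] cos
    by (intro MVBVS_coeff_bound[OF mv]) force
  then obtain B' N' where B': "\<And>n m. n \<ge> N' \<Longrightarrow> m \<in> {n..2*n} \<Longrightarrow> (cmod (?a (s * int m))
      + (\<Sum>k\<in>{n..<m}. cmod (?a (s * int (k + 1)) - ?a (s * int k)))) * ln (real n) \<le> B' * \<psi> n"
    by blast
  have "cmod (?a (s * int n)) * ln (real n) \<le> B' * \<psi> n" if "n \<ge> N'" for n
    using B'[OF that, of n] by simp
  then show ?thesis by blast
qed

text \<open>
  For \<open>n \<le> m < 2n\<close> the norm of \<open>S\<^sub>m f - S\<^sub>n f\<close> is at most a logarithm times the variation of the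
  coefficients. The coefficient bound and the mean value condition make this product \<open>O(\<psi> n)\<close>.
\<close>

lemma L_norm_bound_of_coeff_bound:
  fixes \<psi> :: "nat \<Rightarrow> real"
  assumes f: "f absolutely_integrable_on {-pi..pi}"
    and \<psi>: "decseq \<psi>" "\<And>n. 0 \<le> \<psi> n" and R: "\<And>L. 1 \<le> L \<Longrightarrow> \<exists>D>0. \<forall>n\<ge>L. \<psi> (n div L) \<le> D * \<psi> n"
    and mv: "(\<lambda>n. fourier_coeff f (int n)) \<in> MVBVS" "(\<lambda>n. fourier_coeff f (- int n)) \<in> MVBVS"
    and E: "\<forall>n\<ge>N. best_approx n f \<le> B * \<psi> n"
    and pos: "\<forall>n\<ge>N1. cmod (fourier_coeff f (int n)) * ln (real n) \<le> B1 * \<psi> n"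
    and neg: "\<forall>n\<ge>N2. cmod (fourier_coeff f (- int n)) * ln (real n) \<le> B2 * \<psi> n"
  shows "\<exists>B N. \<forall>n\<ge>N. L_norm (\<lambda>x. f x - fourier_partial_sum n f x) \<le> B * \<psi> n"
proof -
  let ?a = "fourier_coeff f" and ?S = "\<lambda>n. fourier_partial_sum n f"
  let ?V = "\<lambda>(c::nat \<Rightarrow> complex) n m. cmod (c m) + (\<Sum>k\<in>{n..<m}. cmod (c (k + 1) - c k))"
  obtain P N3 where P: "\<And>n m. n \<ge> N3 \<Longrightarrow> m \<in> {n..2*n} \<Longrightarrow> ?V (\<lambda>k. ?a (int k)) n m * ln (real n) \<le> P * \<psi> n"
    using coeff_variation_bound_of_coeff_bound[OF \<psi> R mv(1) pos] by blast
  obtain Q N4 where Q: "\<And>n m. n \<ge> N4 \<Longrightarrow> m \<in> {n..2*n} \<Longrightarrow> ?V (\<lambda>k. ?a (- int k)) n m * ln (real n) \<le> Q * \<psi> n"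
    using coeff_variation_bound_of_coeff_bound[OF \<psi> R mv(2) neg] by blast
  have "L_norm (\<lambda>x. f x - ?S n x) \<le> (4 * B + 4 * pi * (P + Q)) * \<psi> n" if n: "n \<ge> N + N3 + N4 + 1" for n
  proof -
    have "L_norm (\<lambda>x. f x - ?S n x) \<le> 4 * best_approx n f + 4 * pi * ((P + Q) * \<psi> n)"
    proof (rule L_norm_remainder_le_best_approx[OF f])
      fix m assume m: "m \<in> {n..<2*n}"
      let ?v = "?V (\<lambda>k. ?a (int k)) n m" and ?w = "?V (\<lambda>k. ?a (- int k)) n m"
      have nonneg: "0 \<le> ?v" "0 \<le> ?w" by (intro add_nonneg_nonneg sum_nonneg; simp)+
      have "L_norm (\<lambda>x. ?S m x - ?S n x) = L_norm (trig_sum ({- int m..int m} - {- int n..int n}) ?a)"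
        unfolding fourier_partial_sum_def trig_poly_eq_trig_sum
        using m by (subst trig_sum_annulus) auto
      also have "\<dots> \<le> 4 * pi * ln (real (m - n) + 1) * (?v + ?w)"
        using m by (intro L_norm_annulus_le) auto
      also have "\<dots> \<le> 4 * pi * ln (real n) * (?v + ?w)"
        using m nonneg by (intro mult_right_mono mult_left_mono ln_mono) auto
      also have "\<dots> = 4 * pi * (?v * ln (real n) + ?w * ln (real n))"
        by (simp add: algebra_simps)
      also have "\<dots> \<le> 4 * pi * (P * \<psi> n + Q * \<psi> n)"
        using m n by (intro mult_left_mono add_mono P Q) auto
      finally show "L_norm (\<lambda>x. ?S m x - ?S n x) \<le> 4 * pi * ((P + Q) * \<psi> n)"
        by (simp add: algebra_simps)
    qed (use n in simp)
    also have "\<dots> \<le> 4 * (B * \<psi> n) + 4 * pi * ((P + Q) * \<psi> n)" using E n by simp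
    finally show ?thesis by (simp add: algebra_simps)
  qed
  then show ?thesis by blast
qed

section \<open>Asymptotic notation\<close>

lemma bigo_nonneg_iff:
  fixes g \<psi> :: "nat \<Rightarrow> real"
  assumes "\<And>n. 0 \<le> g n" "\<And>n. 0 \<le> \<psi> n"
  shows "g \<in> O(\<psi>) \<longleftrightarrow> (\<exists>B N. \<forall>n\<ge>N. g n \<le> B * \<psi> n)"
proof
  assume "g \<in> O(\<psi>)"
  then obtain B where "\<forall>\<^sub>F n in sequentially. norm (g n) \<le> B * norm (\<psi> n)"
    by (rule landau_o.bigE)
  then show "\<exists>B N. \<forall>n\<ge>N. g n \<le> B * \<psi> n"
    using assms by (auto simp: eventually_sequentially)
next
  assume "\<exists>B N. \<forall>n\<ge>N. g n \<le> B * \<psi> n"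
  then obtain B N where "\<forall>n\<ge>N. g n \<le> B * \<psi> n" by blast
  then show "g \<in> O(\<psi>)"
    using assms by (intro bigoI[of _ B]) (auto simp: eventually_sequentially)
qed

lemma bigo_two_sided_iff:
  fixes a :: "int \<Rightarrow> complex" and \<psi> :: "nat \<Rightarrow> real"
  assumes "\<And>n. 0 \<le> \<psi> n"
  shows "(\<lambda>n::int. a n * of_real (ln \<bar>of_int n\<bar>))
      \<in> O[filtercomap abs at_top](\<lambda>n. of_real (\<psi> (nat \<bar>n\<bar>)))
    \<longleftrightarrow> (\<exists>B N. \<forall>n\<ge>N. cmod (a (int n)) * ln (real n) \<le> B * \<psi> n)
      \<and> (\<exists>B N. \<forall>n\<ge>N. cmod (a (- int n)) * ln (real n) \<le> B * \<psi> n)"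
    (is "?L \<longleftrightarrow> ?P \<and> ?N")
proof
  assume ?L
  then obtain B where "\<forall>\<^sub>F n in filtercomap abs at_top. cmod (a n * of_real (ln \<bar>of_int n\<bar>))
      \<le> B * cmod (of_real (\<psi> (nat \<bar>n\<bar>)))"
    by (rule landau_o.bigE)
  then obtain M where M: "\<And>n. \<bar>n\<bar> \<ge> M \<Longrightarrow> cmod (a n) * \<bar>ln \<bar>real_of_int n\<bar>\<bar> \<le> B * \<psi> (nat \<bar>n\<bar>)"
    using assms unfolding eventually_filtercomap_at_top_linorder by (auto simp: norm_mult)
  have "cmod (a (int n)) * ln (real n) \<le> B * \<psi> n" "cmod (a (- int n)) * ln (real n) \<le> B * \<psi> n"
    if "n \<ge> nat M" for n
  proof -
    have "M \<le> int n" using that by linarith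
    then show "cmod (a (int n)) * ln (real n) \<le> B * \<psi> n" "cmod (a (- int n)) * ln (real n) \<le> B * \<psi> n"
      using M[of "int n"] M[of "- int n"]
        mult_left_mono[OF abs_ge_self[of "ln (real n)"], of "cmod (a (int n))"]
        mult_left_mono[OF abs_ge_self[of "ln (real n)"], of "cmod (a (- int n))"] by auto
  qed
  then show "?P \<and> ?N" by blast
next
  assume "?P \<and> ?N"
  then obtain B N B' N' where P: "\<And>n. n \<ge> N \<Longrightarrow> cmod (a (int n)) * ln (real n) \<le> B * \<psi> n"
    and N: "\<And>n. n \<ge> N' \<Longrightarrow> cmod (a (- int n)) * ln (real n) \<le> B' * \<psi> n"
    by blast
  have "cmod (a n * of_real (ln \<bar>of_int n\<bar>)) \<le> max B B' * cmod (of_real (\<psi> (nat \<bar>n\<bar>)))"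
    if n: "\<bar>n\<bar> \<ge> int (N + N' + 1)" for n
  proof -
    define k where "k = nat \<bar>n\<bar>"
    have k: "k \<ge> N" "k \<ge> N'" "k \<ge> 1" "n = int k \<or> n = - int k" "\<bar>n\<bar> = int k" using n by (auto simp: k_def)
    have "cmod (a n) * ln (real k) \<le> max B B' * \<psi> k"
      using P[OF k(1)] N[OF k(2)] k(4) mult_right_mono[OF max.cobounded1[of B B'] assms[of k]]
        mult_right_mono[OF max.cobounded2[of B' B] assms[of k]] by auto
    moreover have "\<bar>real_of_int n\<bar> = real k" using k(5) by linarith
    ultimately show ?thesis using k(3,5) assms[of k] by (simp add: norm_mult)
  qed
  then show ?L
    by (intro bigoI[of _ "max B B'"]) (auto simp: eventually_filtercomap_at_top_linorder)
qed

section \<open>The equivalence\<close>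

theorem theorem2:
  fixes f :: "real \<Rightarrow> complex" and \<psi> :: "nat \<Rightarrow> real"
  assumes f: "f \<in> L_2pi"
    and decreasing: "decseq \<psi>"
    and null: "\<psi> \<longlonglongrightarrow> 0"
    and doubling: "\<exists>C1>0. \<exists>C2>0. \<forall>n. C1 * \<psi> n \<le> \<psi> (2 * n) \<and> \<psi> (2 * n) \<le> C2 * \<psi> n"
    and pos_coeffs: "(\<lambda>n. fourier_coeff f (int n)) \<in> MVBVS"
    and neg_coeffs: "(\<lambda>n. fourier_coeff f (- int n)) \<in> MVBVS"
  shows "(\<lambda>n. L_norm (\<lambda>x. f x - fourier_partial_sum n f x)) \<in> O(\<psi>) \<longleftrightarrow>
    (\<lambda>n. best_approx n f) \<in> O(\<psi>) \<and>
    (\<lambda>n::int. fourier_coeff f n * of_real (ln \<bar>of_int n\<bar>))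
      \<in> O[filtercomap abs at_top](\<lambda>n. of_real (\<psi> (nat \<bar>n\<bar>)))"
proof -
  have int: "f absolutely_integrable_on {-pi..pi}" using f by (simp add: L_2pi_def)
  \<comment> \<open>A decreasing null sequence is nonnegative.\<close>
  have \<psi>: "0 \<le> \<psi> n" for n by (rule decseq_ge[OF decreasing null])
  obtain C1 where "0 < C1" "\<And>n. C1 * \<psi> n \<le> \<psi> (2 * n)" using doubling by blast
  note R = doubling_div[OF decreasing this]
  have iffs: "(\<lambda>n. L_norm (\<lambda>x. f x - fourier_partial_sum n f x)) \<in> O(\<psi>) \<longleftrightarrow>
      (\<exists>B N. \<forall>n\<ge>N. L_norm (\<lambda>x. f x - fourier_partial_sum n f x) \<le> B * \<psi> n)"
    "(\<lambda>n. best_approx n f) \<in> O(\<psi>) \<longleftrightarrow> (\<exists>B N. \<forall>n\<ge>N. best_approx n f \<le> B * \<psi> n)"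
    by (rule bigo_nonneg_iff; rule L_norm_nonneg best_approx_nonneg \<psi>)+
  show ?thesis
    unfolding iffs bigo_two_sided_iff[where \<psi> = \<psi>, OF \<psi>]
  proof (rule iffI)
    assume "\<exists>B N. \<forall>n\<ge>N. L_norm (\<lambda>x. f x - fourier_partial_sum n f x) \<le> B * \<psi> n"
    then obtain B N where B: "\<forall>n\<ge>N. L_norm (\<lambda>x. f x - fourier_partial_sum n f x) \<le> B * \<psi> n"
      by blast
    note coeff = coeff_bound_of_L_norm_bound[OF int decreasing \<psi> R _ _ B]
    have "\<exists>B N. \<forall>n\<ge>N. best_approx n f \<le> B * \<psi> n"
      using B best_approx_le[of _ f "fourier_coeff f"] unfolding fourier_partial_sum_def
      by (meson order_trans)
    moreover have "\<exists>B N. \<forall>n\<ge>N. cmod (fourier_coeff f (int n)) * ln (real n) \<le> B * \<psi> n"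
      using coeff[of 1] pos_coeffs by simp
    moreover have "\<exists>B N. \<forall>n\<ge>N. cmod (fourier_coeff f (- int n)) * ln (real n) \<le> B * \<psi> n"
      using coeff[of "-1"] neg_coeffs by simp
    ultimately show "(\<exists>B N. \<forall>n\<ge>N. best_approx n f \<le> B * \<psi> n) \<and>
      (\<exists>B N. \<forall>n\<ge>N. cmod (fourier_coeff f (int n)) * ln (real n) \<le> B * \<psi> n) \<and>
      (\<exists>B N. \<forall>n\<ge>N. cmod (fourier_coeff f (- int n)) * ln (real n) \<le> B * \<psi> n)"
      by blast
  next
    assume "(\<exists>B N. \<forall>n\<ge>N. best_approx n f \<le> B * \<psi> n) \<and>
      (\<exists>B N. \<forall>n\<ge>N. cmod (fourier_coeff f (int n)) * ln (real n) \<le> B * \<psi> n) \<and>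
      (\<exists>B N. \<forall>n\<ge>N. cmod (fourier_coeff f (- int n)) * ln (real n) \<le> B * \<psi> n)"
    then obtain B N B1 N1 B2 N2 where E: "\<forall>n\<ge>N. best_approx n f \<le> B * \<psi> n"
      and P: "\<forall>n\<ge>N1. cmod (fourier_coeff f (int n)) * ln (real n) \<le> B1 * \<psi> n"
      and N: "\<forall>n\<ge>N2. cmod (fourier_coeff f (- int n)) * ln (real n) \<le> B2 * \<psi> n"
      by blast
    show "\<exists>B N. \<forall>n\<ge>N. L_norm (\<lambda>x. f x - fourier_partial_sum n f x) \<le> B * \<psi> n"
      by (rule L_norm_bound_of_coeff_bound[OF int decreasing \<psi> _ pos_coeffs neg_coeffs E P N]) (rule R)
  qed
qed

end
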